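(* The image of $A_2$ under the $\mathfrak{sl}_2$ weight system $w_{\mathfrak{sl}_2}\colon A_2\to U(\mathfrak{sl}_2)\otimes U(\mathfrak{sl}_2)$ equals the subalgebra generated by $c_1=c\otimes1$, $c_2=1\otimes c$ and $x=x_1\otimes x_1+x_2\otimes x_2+x_3\otimes x_3$, and these three elements are algebraically independent over $\mathbb C$; i.e. $\operatorname{Im} w_{\mathfrak{sl}_2}=\mathbb C[c_1,c_2,x]$ is a polynomial ring in $c_1,c_2,x$.
   Context: $x_1=\tfrac12\begin{pmatrix}0&1\\1&0\end{pmatrix}$, $x_2=\tfrac12\begin{pmatrix}0&-i\\ i&0\end{pmatrix}$, $x_3=\tfrac12\begin{pmatrix}1&0\\0&-1\end{pmatrix}$ is a basis of $\mathfrak{sl}_2(\mathbb C)$ orthonormal for $(a,b)=2\operatorname{tr}(ab)$, and $c=x_1^2+x_2^2+x_3^2\in U(\mathfrak{sl}_2)$. A chord diagram on two strands (a share) consists of two oriented intervals, strand 1 and strand 2, and finitely many chords, i.e. pairwise disjoint pairs of points of their union (all points distinct), up to orientation-preserving diffeomorphisms of each strand. $A_2$ is the $\mathbb C$-vector space spanned by shares, an algebra under concatenation (strand $i$ of the product is strand $i$ of the first factor followed by strand $i$ of the second). For a share $I$, $w_{\mathfrak{sl}_2}(I)=\sum_{\varphi}P_1^\varphi\otimes P_2^\varphi$, where $\varphi$ runs over maps from the chords to $\{1,2,3\}$ and $P_j^\varphi\in U(\mathfrak{sl}_2)$ is the product, in the order along strand $j$, of $x_{\varphi(\text{chord of }p)}$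 over the chord endpoints $p$ on strand $j$ (empty product $=1$); $w_{\mathfrak{sl}_2}$ is extended linearly. *)

theory Defs
  imports Complex_Main "HOL-Library.FuncSet"
begin

type_synonym mat2 = "nat \<Rightarrow> nat \<Rightarrow> complex"  (* indices 0,1 *)

definition sl2x :: "nat \<Rightarrow> mat2" where
  "sl2x a = (\<lambda>r s.
     if a = 1 then (if r \<noteq> s then 1/2 else 0)
     else if a = 2 then (if r = 0 \<and> s = 1 then - \<i>/2 else if r = 1 \<and> s = 0 then \<i>/2 else 0)
     else if a = 3 then (if r = 0 \<and> s = 0 then 1/2 else if r = 1 \<and> s = 1 then -1/2 else 0)
     else 0)"

definition mmul2 :: "mat2 \<Rightarrow> mat2 \<Rightarrow> mat2" where
  "mmul2 A B = (\<lambda>r s. \<Sum>k<2. A r k * B k s)"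

definition mtr2 :: "mat2 \<Rightarrow> complex" where
  "mtr2 A = (\<Sum>k<2. A k k)"

definition sl2_form :: "mat2 \<Rightarrow> mat2 \<Rightarrow> complex" where
  "sl2_form A B = 2 * mtr2 (mmul2 A B)"

text \<open>Structure constants: [x_a,x_b] = sum_c (([x_a,x_b], x_c)) x_c (the basis is orthonormal).\<close>
definition sl2_struct :: "nat \<Rightarrow> nat \<Rightarrow> nat \<Rightarrow> complex" where
  "sl2_struct a b c =
     sl2_form (\<lambda>r s. mmul2 (sl2x a) (sl2x b) r s - mmul2 (sl2x b) (sl2x a) r s) (sl2x c)"

text \<open>A letter (j,a) with j in {1,2}, a in {1,2,3} stands for x_a placed in tensor factor j,
  i.e. x_a \<otimes> 1 (j = 1) or 1 \<otimes> x_a (j = 2).  Elements of the free algebra are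
  coefficient functions on words.\<close>

type_synonym letter = "nat \<times> nat"
type_synonym felem = "letter list \<Rightarrow> complex"

definition letters :: "letter set" where
  "letters = {1,2} \<times> {1,2,3}"

definition fa_word :: "letter list \<Rightarrow> felem" where
  "fa_word v = (\<lambda>u. if u = v then 1 else 0)"

definition fa_zero :: felem where
  "fa_zero = (\<lambda>_. 0)"

definition fa_add :: "felem \<Rightarrow> felem \<Rightarrow> felem" where
  "fa_add f g = (\<lambda>w. f w + g w)"

definition fa_smult :: "complex \<Rightarrow> felem \<Rightarrow> felem" where
  "fa_smult c f = (\<lambda>w. c * f w)"

definition fa_mult :: "felem \<Rightarrow> felem \<Rightarrow> felem" where
  "fa_mult f g = (\<lambda>w. \<Sum>k\<le>length w. f (take k w) * g (drop k w))"

primrec fa_pow :: "felem \<Rightarrow> nat \<Rightarrow> felem" where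
  "fa_pow f 0 = fa_word []"
| "fa_pow f (Suc n) = fa_mult f (fa_pow f n)"

definition U_rel :: "letter \<Rightarrow> letter \<Rightarrow> felem" where
  "U_rel p q = (\<lambda>w. fa_word [p, q] w - fa_word [q, p] w
      - (if fst p = fst q
         then (\<Sum>c\<in>{1,2,3}. sl2_struct (snd p) (snd q) c * fa_word [(fst p, c)] w)
         else 0))"

inductive_set U_ideal :: "felem set" where
  zero: "fa_zero \<in> U_ideal"
| gen: "\<lbrakk>p \<in> letters; q \<in> letters; set u \<subseteq> letters; set v \<subseteq> letters\<rbrakk>
          \<Longrightarrow> fa_mult (fa_mult (fa_word u) (U_rel p q)) (fa_word v) \<in> U_ideal"
| add: "\<lbrakk>f \<in> U_ideal; g \<in> U_ideal\<rbrakk> \<Longrightarrow> fa_add f g \<in> U_ideal"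
| smult: "f \<in> U_ideal \<Longrightarrow> fa_smult c f \<in> U_ideal"

text \<open>Equality in U(sl_2) \<otimes> U(sl_2).\<close>
definition uequiv :: "felem \<Rightarrow> felem \<Rightarrow> bool" where
  "uequiv f g \<longleftrightarrow> (\<lambda>w. f w - g w) \<in> U_ideal"

text \<open>A share is encoded by the sequences of chord labels met along strand 1 and along
  strand 2; every chord label occurs exactly twice in total (its two endpoints).\<close>
definition is_share :: "nat list \<times> nat list \<Rightarrow> bool" where
  "is_share S \<longleftrightarrow> (\<forall>k \<in> set (fst S @ snd S). count_list (fst S @ snd S) k = 2)"

text \<open>w(S) = sum over phi : chords \<rightarrow> {1,2,3} of P_1 \<otimes> P_2 = (P_1 \<otimes> 1)(1 \<otimes> P_2).\<close>
definition w_sl2 :: "nat list \<times> nat list \<Rightarrow> felem" where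
  "w_sl2 S = (\<lambda>w. \<Sum>\<phi> \<in> (set (fst S @ snd S) \<rightarrow>\<^sub>E {1,2,3}).
       fa_word (map (\<lambda>k. (1, \<phi> k)) (fst S) @ map (\<lambda>k. (2, \<phi> k)) (snd S)) w)"

text \<open>f (mod the ideal) lies in the image of the linear extension of w to A_2.\<close>
definition in_w_image :: "felem \<Rightarrow> bool" where
  "in_w_image f \<longleftrightarrow> (\<exists>L :: (complex \<times> (nat list \<times> nat list)) list.
      (\<forall>(c, S) \<in> set L. is_share S) \<and>
      uequiv f (\<lambda>w. \<Sum>(c, S) \<leftarrow> L. c * w_sl2 S w))"

definition cas1 :: felem where
  "cas1 = (\<lambda>w. \<Sum>i\<in>{1,2,3}. fa_word [(1, i), (1, i)] w)"

definition cas2 :: felem where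
  "cas2 = (\<lambda>w. \<Sum>i\<in>{1,2,3}. fa_word [(2, i), (2, i)] w)"

definition xel :: felem where
  "xel = (\<lambda>w. \<Sum>i\<in>{1,2,3}. fa_word [(1, i), (2, i)] w)"

inductive_set gen_alg :: "felem set" where
  one: "fa_word [] \<in> gen_alg"
| c1: "cas1 \<in> gen_alg"
| c2: "cas2 \<in> gen_alg"
| x: "xel \<in> gen_alg"
| add: "\<lbrakk>f \<in> gen_alg; g \<in> gen_alg\<rbrakk> \<Longrightarrow> fa_add f g \<in> gen_alg"
| smult: "f \<in> gen_alg \<Longrightarrow> fa_smult c f \<in> gen_alg"
| mult: "\<lbrakk>f \<in> gen_alg; g \<in> gen_alg\<rbrakk> \<Longrightarrow> fa_mult f g \<in> gen_alg"

text \<open>Evaluation of a commutative polynomial in three variables (finitely supported coefficient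
  function on exponent triples) at (c_1, c_2, x).\<close>
definition monom3 :: "nat \<times> nat \<times> nat \<Rightarrow> felem" where
  "monom3 m = (case m of (a, b, c) \<Rightarrow>
      fa_mult (fa_pow cas1 a) (fa_mult (fa_pow cas2 b) (fa_pow xel c)))"

definition eval3 :: "(nat \<times> nat \<times> nat \<Rightarrow> complex) \<Rightarrow> felem" where
  "eval3 p = (\<lambda>w. \<Sum>m \<in> {m. p m \<noteq> 0}. p m * monom3 m w)"

end

theory Submission
  imports Defs "HOL-Library.Function_Algebras" "HOL-Library.Multiset" "HOL-Combinatorics.Transposition"
    "HOL-Computational_Algebra.Polynomial"
begin

text \<open>
  Exchanging two neighbouring feet of a chord diagram costs a diagram with one trivalent vertex (a
  Levi-Civita symbol), because of the commutation relations. Two of the three legs of that vertex lie on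
  the same strand. Moving them next to each other costs pairs of Levi-Civita symbols with a common index,
  and these are differences of products of Kronecker symbols, that is, chord diagrams; once the legs are
  adjacent, antisymmetry and one further commutator turn the diagram into shorter ones. Hence, modulo
  shorter chord diagrams, the order of the feet is irrelevant, one may bring the two ends of a chord to
  the front, and there they split off \<open>c\<^sub>1\<close>, \<open>c\<^sub>2\<close> or \<open>x\<close>. Conversely, multiplying by a generator
  prepends a chord.

  For independence, let the algebra act on the tensor product of two dual Verma modules with highest
  weights \<open>l\<^sub>1\<close>, \<open>l\<^sub>2\<close>. There \<open>c\<^sub>1\<close> and \<open>c\<^sub>2\<close> act by \<open>l\<^sub>1(l\<^sub>1 + 2)/4\<close> and \<open>l\<^sub>2(l\<^sub>2 + 2)/4\<close>, and \<open>x\<close> has,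
  on the singular vector of degree \<open>k\<close>, an eigenvalue quadratic in \<open>k\<close>. A polynomial relation therefore
  holds for all values of the first two variables and infinitely many values of the third.
\<close>

section \<open>Preliminaries\<close>

text \<open>As simplification rules these would expand every sum of functions into an abstraction.\<close>

declare plus_fun_apply [simp del] zero_fun_apply [simp del] minus_apply [simp del]

lemma sum_fun_apply: "(\<Sum>i\<in>A. f i) x = (\<Sum>i\<in>A. f i x)"
  by (induction A rule: infinite_finite_induct) (simp_all add: plus_fun_apply zero_fun_apply)

lemma sum_PiE_insert:
  assumes "k \<notin> A"
  shows "(\<Sum>\<phi>\<in>insert k A \<rightarrow>\<^sub>E I. f \<phi>) = (\<Sum>\<phi>\<in>A \<rightarrow>\<^sub>E I. \<Sum>i\<in>I. f (\<phi>(k := i)))"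
proof -
  have "(\<Sum>\<phi>\<in>insert k A \<rightarrow>\<^sub>E I. f \<phi>) = (\<Sum>(i, \<phi>)\<in>I \<times> (A \<rightarrow>\<^sub>E I). f (\<phi>(k := i)))"
    unfolding PiE_insert_eq
    by (subst sum.reindex[OF inj_combinator[OF assms]]) (simp add: case_prod_unfold)
  then show ?thesis by (simp add: sum.swap[of _ I] flip: sum.cartesian_product)
qed

lemma split_list_pair:
  assumes "a \<in> set xs" "b \<in> set xs" "a \<noteq> b"
  obtains u v w where "xs = u @ a # v @ b # w" | u v w where "xs = u @ b # v @ a # w"
proof -
  obtain u w where split: "xs = u @ a # w" using split_list[OF assms(1)] by blast
  then consider (before) "b \<in> set u" | (after) "b \<in> set w" using assms by auto
  then show thesis
  proof cases
    case before
    then show thesis using split_list[of b u] that(2) split by force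
  next
    case after
    then show thesis using split_list[of b w] that(1) split by blast
  qed
qed

section \<open>The free algebra\<close>

lemma fa_zero_eq_0: "fa_zero = 0"
  by (simp add: fa_zero_def zero_fun_def)

lemma fa_add_eq_plus: "fa_add f g = f + g"
  by (simp add: fa_add_def plus_fun_def)

notation fa_smult (infixr "*\<^sub>a" 75)

lemma fa_smult_apply: "(c *\<^sub>a f) w = c * f w"
  by (simp add: fa_smult_def)

lemmas felem_apply = plus_fun_apply zero_fun_apply minus_apply fa_smult_apply sum_fun_apply

interpretation felem: vector_space fa_smult
  by unfold_locales (simp_all add: fun_eq_iff felem_apply algebra_simps)

lemma subspace_mem_of_diff: "felem.subspace V \<Longrightarrow> f - g \<in> V \<Longrightarrow> g \<in> V \<Longrightarrow> f \<in> V"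
  using felem.subspace_add by fastforce

lemma subspace_move:
  assumes "felem.subspace V"
    and "\<And>u q w. q \<in> set v \<Longrightarrow> mset (u @ p # q # w) = M \<Longrightarrow> f (u @ p # q # w) - f (u @ q # p # w) \<in> V"
    and "mset (u @ p # v @ w) = M"
  shows "f (u @ p # v @ w) - f (u @ v @ p # w) \<in> V"
  using assms(2,3)
proof (induction v arbitrary: u)
  case Nil
  then show ?case using felem.subspace_0[OF assms(1)] by simp
next
  case (Cons q v)
  have "f (u @ p # q # v @ w) - f (u @ q # p # v @ w) \<in> V"
    using Cons.prems by (intro Cons.prems(1)) simp_all
  moreover have "f ((u @ [q]) @ p # v @ w) - f ((u @ [q]) @ v @ p # w) \<in> V"
    using Cons.prems by (intro Cons.IH) (simp_all add: add_mset_commute)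
  ultimately show ?case using felem.subspace_add[OF assms(1)] by fastforce
qed

interpretation fa_mult_left: Vector_Spaces.linear fa_smult fa_smult "\<lambda>f. fa_mult f g" for g
  by unfold_locales
    (simp_all add: fun_eq_iff felem_apply fa_mult_def sum.distrib sum_distrib_left algebra_simps)

interpretation fa_mult_right: Vector_Spaces.linear fa_smult fa_smult "fa_mult f" for f
  by unfold_locales
    (simp_all add: fun_eq_iff felem_apply fa_mult_def sum.distrib sum_distrib_left algebra_simps)

lemma fa_mult_word_left:
  "fa_mult (fa_word u) f w = (if take (length u) w = u then f (drop (length u) w) else 0)"
proof -
  have "fa_mult (fa_word u) f w = (\<Sum>k\<le>length w. if take k w = u then f (drop k w) else 0)"
    by (simp add: fa_mult_def fa_word_def if_distrib[of "\<lambda>x. x * _"] cong: if_cong)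
  also have "\<dots> = (\<Sum>k | k \<le> length w \<and> take k w = u. f (drop k w))"
    by (simp add: sum.If_cases Int_def)
  also have "{k. k \<le> length w \<and> take k w = u} = (if take (length u) w = u then {length u} else {})"
    by (auto simp: min_def dest: arg_cong[where f = length] split: if_splits)
  finally show ?thesis by simp
qed

lemma fa_mult_word_word: "fa_mult (fa_word u) (fa_word v) = fa_word (u @ v)"
proof
  fix w
  have "w = u @ v \<longleftrightarrow> take (length u) w = u \<and> drop (length u) w = v"
    by (metis append_eq_conv_conj)
  then show "fa_mult (fa_word u) (fa_word v) w = fa_word (u @ v) w"
    by (simp add: fa_mult_word_left) (simp add: fa_word_def)
qed

lemma fa_mult_one_left: "fa_mult (fa_word []) f = f"
  by (rule ext) (simp add: fa_mult_word_left)

lemma fa_mult_one_right: "fa_mult f (fa_word []) = f"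
proof
  fix w
  have "fa_mult f (fa_word []) w = (\<Sum>k\<in>{length w}. f (take k w) * fa_word [] (drop k w))"
    unfolding fa_mult_def by (intro sum.mono_neutral_right) (auto simp: fa_word_def)
  then show "fa_mult f (fa_word []) w = f w" by (simp add: fa_word_def)
qed

lemma fa_mult_assoc: "fa_mult (fa_mult f g) h = fa_mult f (fa_mult g h)"
proof
  fix w :: "letter list"
  let ?n = "length w"
  let ?t = "\<lambda>j k. f (take j w) * g (take (k - j) (drop j w)) * h (drop k w)"
  have "fa_mult (fa_mult f g) h w = (\<Sum>k\<le>?n. \<Sum>j\<le>k. ?t j k)"
    unfolding fa_mult_def sum_distrib_right
    by (intro sum.cong refl) (auto simp: drop_take min_def)
  also have "\<dots> = (\<Sum>(k, j)\<in>Sigma {..?n} (\<lambda>k. {..k}). ?t j k)"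
    by (simp add: sum.Sigma)
  also have "\<dots> = (\<Sum>(j, i)\<in>Sigma {..?n} (\<lambda>j. {..?n - j}). ?t j (j + i))"
    by (rule sum.reindex_bij_witness[where i="\<lambda>(j, i). (j + i, j)" and j="\<lambda>(k, j). (j, k - j)"])
      auto
  also have "\<dots> = (\<Sum>j\<le>?n. \<Sum>i\<le>?n - j. ?t j (j + i))"
    by (simp add: sum.Sigma)
  also have "\<dots> = fa_mult f (fa_mult g h) w"
    unfolding fa_mult_def sum_distrib_left
    by (intro sum.cong refl) (auto simp: add.commute mult.assoc)
  finally show "fa_mult (fa_mult f g) h w = fa_mult f (fa_mult g h) w" .
qed

lemma inj_fa_word: "inj fa_word"
  by (rule injI) (auto simp: fa_word_def fun_eq_iff split: if_splits)

lemma independent_fa_words: "felem.independent (range fa_word)"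
  unfolding felem.independent_explicit_module
proof (intro allI impI)
  fix t u v assume relation: "finite t" "t \<subseteq> range fa_word" "(\<Sum>f\<in>t. u f *\<^sub>a f) = 0" "v \<in> t"
  then obtain w where word: "v = fa_word w" by blast
  have "u f * f w = (if f = v then u f else 0)" if "f \<in> t" for f
  proof -
    from that relation(2) obtain w' where word': "f = fa_word w'" by blast
    then have "f = v \<longleftrightarrow> w' = w" by (simp add: word inj_eq[OF inj_fa_word])
    moreover have "f w = (if w' = w then 1 else 0)" by (auto simp: word' fa_word_def)
    ultimately show ?thesis by simp
  qed
  then have "(\<Sum>f\<in>t. u f * f w) = (\<Sum>f\<in>t. if f = v then u f else 0)"
    by (rule sum.cong[OF refl])
  also have "\<dots> = u v" using relation(1,4) by simp
  finally show "u v = 0" using fun_cong[OF relation(3), of w] by (simp add: felem_apply)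
qed

definition letter_span :: "felem set" where
  "letter_span = felem.span (fa_word ` lists letters)"

lemma subspace_letter_span: "felem.subspace letter_span"
  by (simp add: letter_span_def)

lemma fa_word_in_letter_span: "set u \<subseteq> letters \<Longrightarrow> fa_word u \<in> letter_span"
  by (auto simp: letter_span_def intro!: felem.span_base)

lemmas letter_span_intros = fa_word_in_letter_span
  felem.subspace_0[OF subspace_letter_span] felem.subspace_add[OF subspace_letter_span]
  felem.subspace_scale[OF subspace_letter_span] felem.subspace_sum[OF subspace_letter_span]

lemma letter_span_induct [consumes 1, case_names zero step, induct set: letter_span]:
  assumes "f \<in> letter_span" "P 0"
    and "\<And>c u g. set u \<subseteq> letters \<Longrightarrow> g \<in> letter_span \<Longrightarrow> P g \<Longrightarrow> P (c *\<^sub>a fa_word u + g)"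
  shows "P f"
proof -
  have "f \<in> letter_span \<and> P f"
    using assms(1)[unfolded letter_span_def]
  proof (induction rule: felem.span_induct_alt)
    case base
    show ?case using assms(2) felem.subspace_0[OF subspace_letter_span] by blast
  next
    case (step c x y)
    then show ?case using assms(3) by (auto simp: lists_eq_set intro: letter_span_intros)
  qed
  then show ?thesis ..
qed

lemma fa_mult_letter_span:
  assumes "f \<in> letter_span" "g \<in> letter_span"
  shows "fa_mult f g \<in> letter_span"
  using assms(1)
proof induction
  case zero
  show ?case using felem.subspace_0[OF subspace_letter_span] by simp
next
  case (step c u f)
  have "fa_mult (fa_word u) g \<in> letter_span"
    using assms(2)
  proof induction
    case (step d v g)
    then show ?case
      using \<open>set u \<subseteq> letters\<close>
      by (simp add: fa_mult_right.add fa_mult_right.scale fa_mult_word_word letter_span_intros)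
  qed (use felem.subspace_0[OF subspace_letter_span] in simp)
  with step.IH show ?case by (simp add: fa_mult_left.add fa_mult_left.scale letter_span_intros)
qed

section \<open>The structure constants\<close>

definition sl2_index :: "nat set" where "sl2_index = {1, 2, 3}"

lemma finite_sl2_index [simp]: "finite sl2_index"
  by (simp add: sl2_index_def)

lemma mem_letters_iff: "(j, a) \<in> letters \<longleftrightarrow> j \<in> {1, 2} \<and> a \<in> sl2_index"
  by (auto simp: letters_def sl2_index_def)

definition levi_civita :: "nat \<Rightarrow> nat \<Rightarrow> nat \<Rightarrow> complex" where
  "levi_civita a b c =
    (if (a, b, c) \<in> {(1, 2, 3), (2, 3, 1), (3, 1, 2)} then 1
     else if (a, b, c) \<in> {(2, 1, 3), (3, 2, 1), (1, 3, 2)} then -1 else 0)"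

lemma levi_civita_cyclic: "levi_civita b c a = levi_civita a b c"
  by (auto simp: levi_civita_def)

lemma levi_civita_antisym: "levi_civita b a c = - levi_civita a b c"
  by (auto simp: levi_civita_def)

lemma levi_civita_permute:
  "levi_civita b c a = levi_civita a b c" "levi_civita c a b = levi_civita a b c"
  "levi_civita b a c = - levi_civita a b c" "levi_civita a c b = - levi_civita a b c"
  "levi_civita c b a = - levi_civita a b c"
  by (metis levi_civita_cyclic levi_civita_antisym)+

lemma levi_civita_rearrange:
  assumes "{#x, y, z#} = {#p, q, r#}"
  obtains s where "\<And>\<phi>. levi_civita (\<phi> x) (\<phi> y) (\<phi> z) = s * levi_civita (\<phi> p) (\<phi> q) (\<phi> r)"
proof -
  have "(x, y, z) \<in> {(p, q, r), (q, r, p), (r, p, q), (q, p, r), (p, r, q), (r, q, p)}"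
    using assms by (auto simp: add_eq_conv_ex)
  then consider (even) "(x, y, z) \<in> {(p, q, r), (q, r, p), (r, p, q)}"
    | (odd) "(x, y, z) \<in> {(q, p, r), (p, r, q), (r, q, p)}"
    by blast
  then show thesis
  proof cases
    case even
    show thesis
    proof (rule that)
      show "levi_civita (\<phi> x) (\<phi> y) (\<phi> z) = 1 * levi_civita (\<phi> p) (\<phi> q) (\<phi> r)" for \<phi>
        using even levi_civita_permute(1,2)[where a = "\<phi> p" and b = "\<phi> q" and c = "\<phi> r"] by auto
    qed
  next
    case odd
    show thesis
    proof (rule that)
      show "levi_civita (\<phi> x) (\<phi> y) (\<phi> z) = -1 * levi_civita (\<phi> p) (\<phi> q) (\<phi> r)" for \<phi>
        using odd levi_civita_permute(3-5)[where a = "\<phi> p" and b = "\<phi> q" and c = "\<phi> r"] by auto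
    qed
  qed
qed

lemma levi_civita_eq_0: "a = b \<or> a = c \<or> b = c \<Longrightarrow> levi_civita a b c = 0"
  by (auto simp: levi_civita_def)

lemma sl2_struct_eq_levi_civita:
  assumes "a \<in> sl2_index" "b \<in> sl2_index" "c \<in> sl2_index"
  shows "sl2_struct a b c = \<i> * levi_civita a b c"
  using assms unfolding sl2_index_def
  by (elim insertE emptyE; simp add: sl2_struct_def sl2_form_def mtr2_def mmul2_def sl2x_def
      levi_civita_def lessThan_Suc numeral_2_eq_2)

lemma levi_civita_contract:
  assumes "a \<in> sl2_index" "b \<in> sl2_index" "c \<in> sl2_index" "d \<in> sl2_index"
  shows "(\<Sum>i\<in>sl2_index. levi_civita i a b * levi_civita i c d)
    = of_bool (a = c \<and> b = d) - of_bool (a = d \<and> b = c)"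
  using assms unfolding sl2_index_def by (elim insertE emptyE; simp add: levi_civita_def)

section \<open>Congruence modulo the ideal\<close>

lemma uequiv_iff_diff: "uequiv f g \<longleftrightarrow> f - g \<in> U_ideal"
  by (simp add: uequiv_def fun_diff_def)

lemma subspace_U_ideal: "felem.subspace U_ideal"
  using U_ideal.zero U_ideal.add U_ideal.smult
  by (intro felem.subspaceI) (simp_all add: fa_zero_eq_0 fa_add_eq_plus)

lemma uequiv_refl [simp]: "uequiv f f"
  using felem.subspace_0[OF subspace_U_ideal] by (simp add: uequiv_iff_diff)

lemma uequiv_trans: "uequiv f g \<Longrightarrow> uequiv g h \<Longrightarrow> uequiv f h"
  using felem.subspace_add[OF subspace_U_ideal, of "f - g" "g - h"] by (simp add: uequiv_iff_diff)

lemma uequiv_add: "uequiv f g \<Longrightarrow> uequiv f' g' \<Longrightarrow> uequiv (f + f') (g + g')"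
  using felem.subspace_add[OF subspace_U_ideal, of "f - g" "f' - g'"]
  by (simp add: uequiv_iff_diff algebra_simps)

lemma uequiv_scale: "uequiv f g \<Longrightarrow> uequiv (c *\<^sub>a f) (c *\<^sub>a g)"
  using felem.subspace_scale[OF subspace_U_ideal, of "f - g" c]
  by (simp add: uequiv_iff_diff felem.scale_right_diff_distrib)

lemma uequiv_sum: "(\<And>i. i \<in> A \<Longrightarrow> uequiv (f i) (g i)) \<Longrightarrow> uequiv (\<Sum>i\<in>A. f i) (\<Sum>i\<in>A. g i)"
  using felem.subspace_sum[OF subspace_U_ideal, of A "\<lambda>i. f i - g i"]
  by (simp add: uequiv_iff_diff sum_subtractf)

lemma U_ideal_mult_word:
  assumes "f \<in> U_ideal" "set u \<subseteq> letters"
  shows "fa_mult (fa_word u) f \<in> U_ideal"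
  using assms(1)
proof induction
  case zero
  then show ?case using U_ideal.zero by (simp add: fa_zero_eq_0)
next
  case (gen p q v v')
  then show ?case
    using U_ideal.gen[of p q "u @ v" v'] assms(2)
    by (simp add: fa_mult_assoc[symmetric] fa_mult_word_word)
next
  case (add f g)
  then show ?case using U_ideal.add by (simp add: fa_add_eq_plus fa_mult_right.add)
next
  case (smult f c)
  then show ?case using U_ideal.smult by (simp add: fa_mult_right.scale)
qed

lemma uequiv_mult_left:
  assumes "h \<in> letter_span" "uequiv f g"
  shows "uequiv (fa_mult h f) (fa_mult h g)"
  using assms(1)
proof induction
  case zero
  show ?case by simp
next
  case (step c u h)
  then have "uequiv (fa_mult (fa_word u) f) (fa_mult (fa_word u) g)"
    using U_ideal_mult_word assms(2) by (simp add: uequiv_iff_diff flip: fa_mult_right.diff)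
  with step show ?case
    by (simp add: fa_mult_left.add fa_mult_left.scale uequiv_add uequiv_scale)
qed

lemma fa_mult_U_rel:
  assumes "p \<in> letters" "q \<in> letters"
  shows "fa_mult (fa_mult (fa_word u) (U_rel p q)) (fa_word v)
    = fa_word (u @ p # q # v) - fa_word (u @ q # p # v)
      - (if fst p = fst q
         then \<Sum>c\<in>sl2_index. (\<i> * levi_civita (snd p) (snd q) c) *\<^sub>a fa_word (u @ (fst p, c) # v) else 0)"
proof -
  have "U_rel p q = fa_word [p, q] - fa_word [q, p]
      - (if fst p = fst q
         then \<Sum>c\<in>sl2_index. (\<i> * levi_civita (snd p) (snd q) c) *\<^sub>a fa_word [(fst p, c)] else 0)"
  proof -
    have "snd p \<in> sl2_index" "snd q \<in> sl2_index"
      using assms by (auto simp: letters_def sl2_index_def)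
    then show ?thesis
      unfolding U_rel_def sl2_index_def[symmetric]
      by (auto simp: fun_eq_iff felem_apply sl2_struct_eq_levi_civita intro!: sum.cong)
  qed
  then show ?thesis
    by (simp add: fa_mult_right.diff fa_mult_left.diff fa_mult_right.sum fa_mult_left.sum
        fa_mult_right.scale fa_mult_left.scale fa_mult_word_word)
qed

lemma uequiv_word_swap:
  assumes "p \<in> letters" "q \<in> letters" "set u \<subseteq> letters" "set v \<subseteq> letters"
  shows "uequiv (fa_word (u @ p # q # v))
    (fa_word (u @ q # p # v)
      + (if fst p = fst q
         then \<Sum>c\<in>sl2_index. (\<i> * levi_civita (snd p) (snd q) c) *\<^sub>a fa_word (u @ (fst p, c) # v) else 0))"
  using U_ideal.gen[OF assms] by (simp add: uequiv_iff_diff fa_mult_U_rel[OF assms(1,2)] algebra_simps)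

section \<open>Contracted words\<close>

text \<open>Letters here carry a label in place of an index: a label occurring twice in the word is a chord,
  and the tensor \<open>T\<close> couples the labels further.\<close>

definition contract :: "nat set \<Rightarrow> ((nat \<Rightarrow> nat) \<Rightarrow> complex) \<Rightarrow> letter list \<Rightarrow> felem" where
  "contract K T ls = (\<Sum>\<phi>\<in>K \<rightarrow>\<^sub>E sl2_index. T \<phi> *\<^sub>a fa_word (map (apsnd \<phi>) ls))"

abbreviation chord_diagram :: "nat set \<Rightarrow> letter list \<Rightarrow> felem" where
  "chord_diagram K \<equiv> contract K (\<lambda>_. 1)"

abbreviation trivalent :: "nat set \<Rightarrow> nat \<Rightarrow> nat \<Rightarrow> nat \<Rightarrow> letter list \<Rightarrow> felem" where
  "trivalent K x y z \<equiv> contract K (\<lambda>\<phi>. levi_civita (\<phi> x) (\<phi> y) (\<phi> z))"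

lemma contract_cong:
  "(\<And>\<phi>. \<phi> \<in> K \<rightarrow>\<^sub>E sl2_index \<Longrightarrow> T \<phi> = T' \<phi>) \<Longrightarrow> contract K T ls = contract K T' ls"
  by (simp add: contract_def)

lemma contract_scale: "contract K (\<lambda>\<phi>. c * T \<phi>) ls = c *\<^sub>a contract K T ls"
  by (simp add: contract_def felem.scale_sum_right)

lemma contract_diff: "contract K (\<lambda>\<phi>. T \<phi> - T' \<phi>) ls = contract K T ls - contract K T' ls"
  by (simp add: contract_def felem.scale_left_diff_distrib sum_subtractf)

lemma contract_insert:
  assumes "c \<notin> K"
  shows "contract (insert c K) T ls
    = (\<Sum>\<phi>\<in>K \<rightarrow>\<^sub>E sl2_index. \<Sum>i\<in>sl2_index. T (\<phi>(c := i)) *\<^sub>a fa_word (map (apsnd (\<phi>(c := i))) ls))"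
  using assms by (simp add: contract_def sum_PiE_insert del: fun_upd_apply)

lemma map_apsnd_fun_upd_other: "c \<notin> snd ` set ls \<Longrightarrow> map (apsnd (f(c := i))) ls = map (apsnd f) ls"
  by (force simp: apsnd_def map_prod_def)

lemma map_apsnd_comp: "map (apsnd (f \<circ> g)) ls = map (apsnd f) (map (apsnd g) ls)"
  by (simp add: apsnd_compose)

lemma set_map_apsnd_subset_letters:
  assumes "fst ` set ls \<subseteq> {1, 2}" "snd ` set ls \<subseteq> K" "\<phi> \<in> K \<rightarrow>\<^sub>E sl2_index"
  shows "set (map (apsnd \<phi>) ls) \<subseteq> letters"
  using assms by (fastforce simp: mem_letters_iff)

lemma contract_levi_civita:
  assumes "c \<notin> K" "snd ` set (u @ v) \<subseteq> K" "a \<in> K" "b \<in> K" "\<And>\<phi> i. T (\<phi>(c := i)) = T \<phi>"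
  shows "(\<Sum>\<phi>\<in>K \<rightarrow>\<^sub>E sl2_index. T \<phi> *\<^sub>a (\<Sum>i\<in>sl2_index. (\<i> * levi_civita (\<phi> a) (\<phi> b) i) *\<^sub>a
      fa_word (map (apsnd \<phi>) u @ (j, i) # map (apsnd \<phi>) v)))
    = \<i> *\<^sub>a contract (insert c K) (\<lambda>\<phi>. T \<phi> * levi_civita (\<phi> a) (\<phi> b) (\<phi> c)) (u @ (j, c) # v)"
proof -
  have "c \<notin> snd ` set u" "c \<notin> snd ` set v" "a \<noteq> c" "b \<noteq> c" using assms(1-4) by auto
  then show ?thesis
    unfolding contract_insert[OF assms(1)] assms(5)
    by (simp add: map_apsnd_fun_upd_other felem.scale_sum_right mult.left_commute)
qed

lemma contract_swap:
  assumes "fst ` set (u @ (j, a) # (k, b) # v) \<subseteq> {1, 2}" "snd ` set (u @ (j, a) # (k, b) # v) \<subseteq> K"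
    and "c \<notin> K" "\<And>\<phi> i. T (\<phi>(c := i)) = T \<phi>"
  shows "uequiv (contract K T (u @ (j, a) # (k, b) # v))
    (contract K T (u @ (k, b) # (j, a) # v)
      + (if j = k
         then \<i> *\<^sub>a contract (insert c K) (\<lambda>\<phi>. T \<phi> * levi_civita (\<phi> a) (\<phi> b) (\<phi> c)) (u @ (j, c) # v)
         else 0))"
proof -
  let ?C = "\<lambda>\<phi>. \<Sum>i\<in>sl2_index. (\<i> * levi_civita (\<phi> a) (\<phi> b) i) *\<^sub>a
    fa_word (map (apsnd \<phi>) u @ (j, i) # map (apsnd \<phi>) v)"
  have commutator: "(\<Sum>\<phi>\<in>K \<rightarrow>\<^sub>E sl2_index. T \<phi> *\<^sub>a ?C \<phi>) =
      \<i> *\<^sub>a contract (insert c K) (\<lambda>\<phi>. T \<phi> * levi_civita (\<phi> a) (\<phi> b) (\<phi> c)) (u @ (j, c) # v)"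
    using assms(2-4) by (intro contract_levi_civita) auto
  have "uequiv (fa_word (map (apsnd \<phi>) (u @ (j, a) # (k, b) # v)))
      (fa_word (map (apsnd \<phi>) (u @ (k, b) # (j, a) # v)) + (if j = k then ?C \<phi> else 0))"
    if "\<phi> \<in> K \<rightarrow>\<^sub>E sl2_index" for \<phi>
  proof -
    have "set (map (apsnd \<phi>) (u @ (j, a) # (k, b) # v)) \<subseteq> letters"
      using assms(1,2) that by (rule set_map_apsnd_subset_letters)
    then have "(j, \<phi> a) \<in> letters" "(k, \<phi> b) \<in> letters"
      "set (map (apsnd \<phi>) u) \<subseteq> letters" "set (map (apsnd \<phi>) v) \<subseteq> letters" by simp_all
    from uequiv_word_swap[OF this] show ?thesis by (cases "j = k") simp_all
  qed
  then have "uequiv (contract K T (u @ (j, a) # (k, b) # v))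
      (\<Sum>\<phi>\<in>K \<rightarrow>\<^sub>E sl2_index. T \<phi> *\<^sub>a
        (fa_word (map (apsnd \<phi>) (u @ (k, b) # (j, a) # v)) + (if j = k then ?C \<phi> else 0)))"
    unfolding contract_def by (intro uequiv_sum uequiv_scale)
  then show ?thesis
    using commutator
    by (cases "j = k")
      (simp_all only: felem.scale_right_distrib sum.distrib contract_def[of K] if_True if_False
        felem.scale_zero_right sum.neutral_const simp_thms)
qed

lemma contract_transpose:
  assumes "a \<in> K" "b \<in> K"
  shows "contract K T (map (apsnd (transpose a b)) ls) = contract K (\<lambda>\<phi>. T (\<phi> \<circ> transpose a b)) ls"
proof -
  have closed: "\<phi> \<circ> transpose a b \<in> K \<rightarrow>\<^sub>E sl2_index" if "\<phi> \<in> K \<rightarrow>\<^sub>E sl2_index" for \<phi>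
    using that assms by (auto simp: PiE_iff extensional_def transpose_def)
  show ?thesis
    unfolding contract_def
    by (intro sum.reindex_bij_witness[where i = "\<lambda>\<phi>. \<phi> \<circ> transpose a b" and j = "\<lambda>\<phi>. \<phi> \<circ> transpose a b"])
      (simp_all only: closed comp_assoc map_apsnd_comp transpose_comp_involutory comp_id)
qed

lemma contract_merge:
  assumes "p \<in> K" "q \<in> K" "p \<noteq> q"
  shows "contract K (\<lambda>\<phi>. of_bool (\<phi> p = \<phi> q) * T \<phi>) ls
    = contract (K - {p}) (\<lambda>\<phi>. T (\<phi> \<circ> id(p := q))) (map (apsnd (id(p := q))) ls)"
proof -
  have "contract K (\<lambda>\<phi>. of_bool (\<phi> p = \<phi> q) * T \<phi>) ls
      = contract (insert p (K - {p})) (\<lambda>\<phi>. of_bool (\<phi> p = \<phi> q) * T \<phi>) ls"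
    using assms(1) by (simp add: insert_absorb)
  also have "\<dots> = (\<Sum>\<phi>\<in>K - {p} \<rightarrow>\<^sub>E sl2_index. \<Sum>i\<in>sl2_index.
      (of_bool (i = \<phi> q) * T (\<phi>(p := i))) *\<^sub>a fa_word (map (apsnd (\<phi>(p := i))) ls))"
    using assms(3) by (subst contract_insert) simp_all
  also have "\<dots> = (\<Sum>\<phi>\<in>K - {p} \<rightarrow>\<^sub>E sl2_index. T (\<phi>(p := \<phi> q)) *\<^sub>a fa_word (map (apsnd (\<phi>(p := \<phi> q))) ls))"
  proof (intro sum.cong refl)
    fix \<phi> assume "\<phi> \<in> K - {p} \<rightarrow>\<^sub>E sl2_index"
    then have "\<phi> q \<in> sl2_index" using assms(2,3) by auto
    moreover have "(of_bool (i = \<phi> q) * c) *\<^sub>a f = (if i = \<phi> q then c *\<^sub>a f else 0)" for i c f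
      by simp
    ultimately show "(\<Sum>i\<in>sl2_index.
          (of_bool (i = \<phi> q) * T (\<phi>(p := i))) *\<^sub>a fa_word (map (apsnd (\<phi>(p := i))) ls))
        = T (\<phi>(p := \<phi> q)) *\<^sub>a fa_word (map (apsnd (\<phi>(p := \<phi> q))) ls)"
      by (simp only: sum.delta finite_sl2_index if_True)
  qed
  also have "\<dots> = contract (K - {p}) (\<lambda>\<phi>. T (\<phi> \<circ> id(p := q))) (map (apsnd (id(p := q))) ls)"
  proof -
    have "\<phi>(p := \<phi> q) = \<phi> \<circ> id(p := q)" for \<phi> :: "nat \<Rightarrow> nat" by auto
    then show ?thesis unfolding contract_def by (simp only: map_apsnd_comp)
  qed
  finally show ?thesis .
qed

section \<open>Diagrams\<close>

definition paired :: "'a multiset \<Rightarrow> bool" where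
  "paired M \<longleftrightarrow> (\<forall>k\<in>#M. count M k = 2)"

lemma paired_add_pair: "k \<notin># M \<Longrightarrow> paired (add_mset k (add_mset k M)) \<longleftrightarrow> paired M"
  by (auto simp: paired_def count_eq_zero_iff)

lemma paired_remove_pair:
  assumes "paired (add_mset k (add_mset k M))"
  shows "k \<notin># M" "paired M"
proof -
  show "k \<notin># M" using assms by (simp add: paired_def flip: count_eq_zero_iff)
  with assms show "paired M" by (simp add: paired_add_pair)
qed

lemma paired_merge:
  assumes "paired (add_mset p (add_mset q M))" "p \<noteq> q"
  shows "paired (image_mset (id(p := q)) M)"
proof -
  have "count (image_mset (id(p := q)) M) k
      = (if k = q then count M p + count M q else if k = p then 0 else count M k)" for k
    using assms(2) by (induction M) auto
  then show ?thesis
    using assms by (auto simp: paired_def split: if_splits)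
qed

text \<open>\<open>K\<close> contains the labels, \<open>E\<close> those used by the tensor and \<open>M\<close> the letters of the word. A label of
  \<open>K\<close> that does not occur at all is allowed and contributes a factor 3.\<close>

definition is_diagram :: "nat set \<Rightarrow> nat multiset \<Rightarrow> letter multiset \<Rightarrow> bool" where
  "is_diagram K E M \<longleftrightarrow> finite K \<and> fst ` set_mset M \<subseteq> {1, 2} \<and>
    set_mset (E + image_mset snd M) \<subseteq> K \<and> paired (E + image_mset snd M)"

lemma diagram_merge:
  assumes "is_diagram K (add_mset p (add_mset q E)) M" "p \<noteq> q"
  shows "is_diagram (K - {p}) (image_mset (id(p := q)) E) (image_mset (apsnd (id(p := q))) M)"
proof -
  let ?M = "E + image_mset snd M"
  have "paired (image_mset (id(p := q)) ?M)"
    using assms by (intro paired_merge) (simp_all add: is_diagram_def)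
  moreover have "id(p := q) ` set_mset ?M \<subseteq> K - {p}"
    using assms unfolding is_diagram_def by auto
  ultimately show ?thesis
    using assms(1)
    by (simp add: is_diagram_def multiset.map_comp comp_def image_image image_Un del: fun_upd_apply)
qed

lemma diagram_remove_loop: "is_diagram K (add_mset p (add_mset p E)) M \<Longrightarrow> is_diagram K E M"
  using paired_remove_pair(2)[of p "E + image_mset snd M"] by (simp add: is_diagram_def)

lemma diagram_remove_label:
  assumes "is_diagram K (add_mset k (add_mset k E)) M"
  shows "k \<notin># E" "k \<notin> snd ` set_mset M" "is_diagram (K - {k}) E M"
proof -
  have rest: "k \<notin># E + image_mset snd M" "paired (E + image_mset snd M)"
    using assms paired_remove_pair[of k "E + image_mset snd M"] by (simp_all add: is_diagram_def)
  then show absent: "k \<notin># E" "k \<notin> snd ` set_mset M" by auto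
  show "is_diagram (K - {k}) E M"
    using assms rest(2) absent unfolding is_diagram_def by force
qed

lemma diagram_leg_exists:
  assumes "is_diagram K E (mset ls)" "count E k = 1"
  shows "\<exists>j\<in>{1, 2}. (j, k) \<in> set ls"
proof -
  let ?N = "image_mset snd (mset ls)"
  have "k \<in># E" using assms(2) by (simp flip: count_greater_zero_iff)
  then have "count (E + ?N) k = 2" using assms(1) by (simp add: is_diagram_def paired_def)
  with assms(2) have "count ?N k \<noteq> 0" unfolding count_union by linarith
  then have "k \<in># ?N" by (simp only: count_eq_zero_iff not_not)
  then obtain j where leg: "(j, k) \<in> set ls" by auto
  with assms(1) have "j \<in> {1, 2}" by (auto simp: is_diagram_def image_subset_iff)
  with leg show ?thesis by blast
qed

lemma diagram_commutator:
  assumes "is_diagram K E (mset (u @ (j, a) # (k, b) # v))" "c \<notin> K"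
  shows "is_diagram (insert c K) ({#a, b, c#} + E) (mset (u @ (j, c) # v))"
proof -
  let ?M = "E + image_mset snd (mset (u @ (j, a) # (k, b) # v))"
  have "c \<notin># ?M" using assms by (auto simp: is_diagram_def)
  moreover have labels: "{#a, b, c#} + E + image_mset snd (mset (u @ (j, c) # v))
      = add_mset c (add_mset c ?M)"
    by simp
  ultimately have "paired ({#a, b, c#} + E + image_mset snd (mset (u @ (j, c) # v)))"
    using assms(1) unfolding labels by (subst paired_add_pair) (simp_all add: is_diagram_def)
  then show ?thesis using assms(1) unfolding is_diagram_def by auto
qed

definition chord_span :: "nat \<Rightarrow> felem set" where
  "chord_span n = felem.span
    (U_ideal \<union> {chord_diagram K ls |K ls. is_diagram K {#} (mset ls) \<and> length ls \<le> n})"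

lemma subspace_chord_span: "felem.subspace (chord_span n)"
  by (simp add: chord_span_def)

lemma U_ideal_subset_chord_span: "U_ideal \<subseteq> chord_span n"
  unfolding chord_span_def using felem.span_superset by blast

lemma chord_diagram_in_chord_span:
  "is_diagram K {#} (mset ls) \<Longrightarrow> length ls \<le> n \<Longrightarrow> chord_diagram K ls \<in> chord_span n"
  unfolding chord_span_def by (intro felem.span_base) blast

lemma chord_span_diff_uequiv:
  assumes "uequiv f (g + h)" "h \<in> chord_span n"
  shows "f - g \<in> chord_span n"
proof -
  have "(f - (g + h)) + h \<in> chord_span n"
    using assms U_ideal_subset_chord_span unfolding uequiv_iff_diff
    by (intro felem.subspace_add[OF subspace_chord_span]) auto
  then show ?thesis by simp
qed

lemma contract_swap_in_chord_span:
  assumes "is_diagram K E (mset (u @ (j, a) # (k, b) # v))"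
    and "\<And>c \<phi> i. c \<notin> K \<Longrightarrow> T (\<phi>(c := i)) = T \<phi>"
    and "\<And>c. c \<notin> K \<Longrightarrow>
      contract (insert c K) (\<lambda>\<phi>. T \<phi> * levi_civita (\<phi> a) (\<phi> b) (\<phi> c)) (u @ (j, c) # v) \<in> chord_span n"
  shows "contract K T (u @ (j, a) # (k, b) # v) - contract K T (u @ (k, b) # (j, a) # v) \<in> chord_span n"
proof -
  obtain c where fresh: "c \<notin> K"
    using ex_new_if_finite[OF infinite_UNIV_nat, of K] assms(1) by (auto simp: is_diagram_def)
  have "fst ` set (u @ (j, a) # (k, b) # v) \<subseteq> {1, 2}" "snd ` set (u @ (j, a) # (k, b) # v) \<subseteq> K"
    using assms(1) by (auto simp: is_diagram_def)
  from contract_swap[OF this fresh, of T, OF assms(2)[OF fresh]] show ?thesis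
    using assms(3)[OF fresh]
      felem.subspace_0[OF subspace_chord_span] felem.subspace_scale[OF subspace_chord_span]
    by (elim chord_span_diff_uequiv) auto
qed

definition kronecker :: "(nat \<times> nat) list \<Rightarrow> (nat \<Rightarrow> nat) \<Rightarrow> complex" where
  "kronecker es \<phi> = of_bool (\<forall>(p, q)\<in>set es. \<phi> p = \<phi> q)"

definition edge_ends :: "(nat \<times> nat) list \<Rightarrow> nat multiset" where
  "edge_ends es = mset (concat (map (\<lambda>(p, q). [p, q]) es))"

lemma kronecker_simps [simp]:
  "kronecker [] \<phi> = 1" "kronecker ((p, q) # es) \<phi> = of_bool (\<phi> p = \<phi> q) * kronecker es \<phi>"
  by (simp_all add: kronecker_def of_bool_conj)

lemma edge_ends_simps [simp]:
  "edge_ends [] = {#}" "edge_ends ((p, q) # es) = add_mset p (add_mset q (edge_ends es))"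
  by (simp_all add: edge_ends_def)

lemma kronecker_map: "kronecker (map (map_prod f f) es) \<phi> = kronecker es (\<phi> \<circ> f)"
  by (induction es) auto

lemma edge_ends_map: "edge_ends (map (map_prod f f) es) = image_mset f (edge_ends es)"
  by (induction es) auto

lemma contract_kronecker_in_chord_span:
  assumes "is_diagram K (edge_ends es) (mset ls)"
  shows "contract K (kronecker es) ls \<in> chord_span (length ls)"
  using assms
proof (induction "length es" arbitrary: es K ls)
  case 0
  then show ?case by (simp add: chord_diagram_in_chord_span)
next
  case (Suc n)
  then obtain p q es' where split: "es = (p, q) # es'" and len: "n = length es'"
    by (cases es) auto
  have diagram: "is_diagram K (add_mset p (add_mset q (edge_ends es'))) (mset ls)"
    using Suc.prems by (simp add: split)
  show ?case
  proof (cases "p = q")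
    case True
    then have "kronecker es = kronecker es'" by (simp add: split fun_eq_iff)
    then show ?thesis
      using Suc.hyps(1)[OF len, of K ls] diagram diagram_remove_loop True by simp
  next
    case False
    let ?f = "id(p := q)"
    let ?es = "map (map_prod ?f ?f) es'"
    have "contract K (kronecker es) ls = contract K (\<lambda>\<phi>. of_bool (\<phi> p = \<phi> q) * kronecker es' \<phi>) ls"
      by (intro contract_cong) (simp add: split)
    also have "\<dots> = contract (K - {p}) (\<lambda>\<phi>. kronecker es' (\<phi> \<circ> ?f)) (map (apsnd ?f) ls)"
      using diagram False by (intro contract_merge) (auto simp: is_diagram_def)
    also have "\<dots> = contract (K - {p}) (kronecker ?es) (map (apsnd ?f) ls)"
      by (intro contract_cong) (simp only: kronecker_map)
    also have "\<dots> \<in> chord_span (length (map (apsnd ?f) ls))"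
    proof (rule Suc.hyps(1))
      show "is_diagram (K - {p}) (edge_ends ?es) (mset (map (apsnd ?f) ls))"
        using diagram_merge[OF diagram False] by (simp only: edge_ends_map mset_map)
    qed (simp add: len)
    finally show ?thesis by simp
  qed
qed

lemma levi_civita_pair_in_chord_span:
  assumes "is_diagram K {#x, b, c, x, y, z#} (mset ls)"
  shows "contract K (\<lambda>\<phi>. levi_civita (\<phi> x) (\<phi> y) (\<phi> z) * levi_civita (\<phi> x) (\<phi> b) (\<phi> c)) ls
    \<in> chord_span (length ls)" (is "contract K ?T ls \<in> _")
proof -
  let ?es = "[(y, b), (z, c)]" and ?es' = "[(y, c), (z, b)]" and ?K = "K - {x}"
  have diagram: "is_diagram K (add_mset x (add_mset x {#y, b, z, c#})) (mset ls)"
    using assms by (simp add: add_mset_commute)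
  note removed = diagram_remove_label[OF diagram]
  have labels: "{y, z, b, c} \<subseteq> ?K" using removed(3) by (auto simp: is_diagram_def)
  have "contract K ?T ls = contract (insert x ?K) ?T ls"
    using assms by (simp add: is_diagram_def insert_absorb)
  also have "\<dots> = (\<Sum>\<phi>\<in>?K \<rightarrow>\<^sub>E sl2_index. (\<Sum>i\<in>sl2_index.
      levi_civita i (\<phi> y) (\<phi> z) * levi_civita i (\<phi> b) (\<phi> c)) *\<^sub>a fa_word (map (apsnd \<phi>) ls))"
    using removed by (subst contract_insert) (simp_all add: map_apsnd_fun_upd_other felem.scale_sum_left)
  also have "\<dots> = contract ?K (\<lambda>\<phi>. kronecker ?es \<phi> - kronecker ?es' \<phi>) ls"
    unfolding contract_def
    by (intro sum.cong refl arg_cong2[where f = fa_smult], subst levi_civita_contract)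
      (use labels in \<open>auto simp: PiE_iff kronecker_def simp del: kronecker_simps\<close>)
  also have "\<dots> = contract ?K (kronecker ?es) ls - contract ?K (kronecker ?es') ls"
    by (rule contract_diff)
  also have "\<dots> \<in> chord_span (length ls)"
    using removed(3) by (intro felem.subspace_diff[OF subspace_chord_span] contract_kronecker_in_chord_span)
      (simp_all add: add_mset_commute)
  finally show ?thesis .
qed

section \<open>Diagrams with one trivalent vertex\<close>

lemma trivalent_swap:
  assumes "is_diagram K {#x, y, z#} (mset (u @ (j, x) # (k, b) # v))" "n = Suc (length (u @ v))"
  shows "trivalent K x y z (u @ (j, x) # (k, b) # v) - trivalent K x y z (u @ (k, b) # (j, x) # v)
    \<in> chord_span n"
proof (rule contract_swap_in_chord_span[OF assms(1)])
  fix c assume fresh: "c \<notin> K"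
  have "{x, y, z} \<subseteq> K" using assms(1) by (auto simp: is_diagram_def)
  with fresh show "levi_civita ((\<phi>(c := i)) x) ((\<phi>(c := i)) y) ((\<phi>(c := i)) z)
      = levi_civita (\<phi> x) (\<phi> y) (\<phi> z)" for \<phi> i by auto
  show "contract (insert c K)
      (\<lambda>\<phi>. levi_civita (\<phi> x) (\<phi> y) (\<phi> z) * levi_civita (\<phi> x) (\<phi> b) (\<phi> c)) (u @ (j, c) # v) \<in> chord_span n"
    using levi_civita_pair_in_chord_span[of "insert c K" x b c y z "u @ (j, c) # v"]
      diagram_commutator[OF assms(1) fresh] assms(2) by (simp add: add_mset_commute)
qed

lemma trivalent_antisym:
  assumes "x \<in> K" "y \<in> K" "x \<noteq> z" "y \<noteq> z" "x \<notin> snd ` set (u @ w)" "y \<notin> snd ` set (u @ w)"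
  shows "trivalent K x y z (u @ (j, y) # (j, x) # w) = - trivalent K x y z (u @ (j, x) # (j, y) # w)"
proof -
  have "map (apsnd (transpose x y)) l = l" if "x \<notin> snd ` set l" "y \<notin> snd ` set l" for l :: "letter list"
    using that by (intro map_idI) (force simp: transpose_def)
  then have "map (apsnd (transpose x y)) (u @ (j, x) # (j, y) # w) = u @ (j, y) # (j, x) # w"
    using assms(5,6) by (simp add: image_Un)
  then have "trivalent K x y z (u @ (j, y) # (j, x) # w)
      = contract K (\<lambda>\<phi>. levi_civita (\<phi> y) (\<phi> x) (\<phi> z)) (u @ (j, x) # (j, y) # w)"
    using contract_transpose[OF assms(1,2), of "\<lambda>\<phi>. levi_civita (\<phi> x) (\<phi> y) (\<phi> z)"
        "u @ (j, x) # (j, y) # w"] assms(3,4) by simp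
  also have "\<dots> = - trivalent K x y z (u @ (j, x) # (j, y) # w)"
    using contract_scale[of K "-1"] by (simp add: levi_civita_permute(3)[of "_ y" "_ x"])
  finally show ?thesis .
qed

lemma trivalent_same_strand_in_chord_span:
  assumes diagram: "is_diagram K {#x, y, z#} (mset (u @ (j, x) # v @ (j, y) # w))"
    and distinct: "x \<noteq> y" "x \<noteq> z" "y \<noteq> z"
    and len: "length (u @ (j, x) # v @ (j, y) # w) = Suc n"
  shows "trivalent K x y z (u @ (j, x) # v @ (j, y) # w) \<in> chord_span n"
proof -
  let ?D = "trivalent K x y z"
  let ?M = "mset (u @ (j, x) # v @ (j, y) # w)"
  have swap: "?D (u' @ (j, x) # q # w') - ?D (u' @ q # (j, x) # w') \<in> chord_span n"
    if "mset (u' @ (j, x) # q # w') = ?M" for u' q w'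
    using trivalent_swap[of K x y z u' j "fst q" "snd q" w' n] diagram len that mset_eq_length[OF that]
    by simp
  have move: "?D (u @ (j, x) # v @ (j, y) # w) - ?D (u @ v @ (j, x) # (j, y) # w) \<in> chord_span n"
    by (rule subspace_move[where f = ?D and M = ?M]) (simp_all add: subspace_chord_span swap)
  let ?f = "?D ((u @ v) @ (j, x) # (j, y) # w)"
  have "?f - ?D ((u @ v) @ (j, y) # (j, x) # w) \<in> chord_span n"
    by (rule swap) (simp add: add_mset_commute)
  moreover have "?D ((u @ v) @ (j, y) # (j, x) # w) = - ?f"
  proof (rule trivalent_antisym)
    let ?N = "image_mset snd (mset (u @ v @ w))"
    have "paired ({#x, x, y, y, z#} + ?N)"
      using diagram by (simp add: is_diagram_def add_mset_commute)
    then have "x \<notin># ?N" "y \<notin># ?N"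
      using paired_remove_pair(1)[of x "{#y, y, z#} + ?N"] paired_remove_pair(1)[of y "{#x, x, z#} + ?N"]
      by (simp_all add: add_mset_commute)
    then show "x \<notin> snd ` set ((u @ v) @ w)" "y \<notin> snd ` set ((u @ v) @ w)"
      by (simp_all add: image_Un)
  qed (use diagram distinct in \<open>simp_all add: is_diagram_def\<close>)
  ultimately have "(1 / 2) *\<^sub>a (?f + ?f) \<in> chord_span n"
    by (intro felem.subspace_scale[OF subspace_chord_span]) simp
  moreover have "(1 / 2) *\<^sub>a (?f + ?f) = ?f"
    by (simp add: fun_eq_iff felem_apply)
  ultimately have "?f \<in> chord_span n" by simp
  then show ?thesis
    using felem.subspace_add[OF subspace_chord_span move, of ?f] by simp
qed

lemma trivalent_rearranged_in_chord_span:
  assumes diagram: "is_diagram K {#x, y, z#} (mset ls)" and len: "length ls = Suc n"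
    and word: "ls = u @ (l, p) # v @ (l, q) # w"
    and legs: "{#x, y, z#} = {#p, q, r#}" "p \<noteq> q" "p \<noteq> r" "q \<noteq> r"
  shows "trivalent K x y z ls \<in> chord_span n"
proof -
  obtain s where "\<And>\<phi>. levi_civita (\<phi> x) (\<phi> y) (\<phi> z) = s * levi_civita (\<phi> p) (\<phi> q) (\<phi> r)"
    using levi_civita_rearrange[OF legs(1)] by blast
  then have "trivalent K x y z ls = s *\<^sub>a trivalent K p q r ls"
    by (simp add: contract_scale)
  moreover have "trivalent K p q r ls \<in> chord_span n"
    using trivalent_same_strand_in_chord_span[of K p q r u l v w n] diagram len legs by (simp add: word)
  ultimately show ?thesis
    using felem.subspace_scale[OF subspace_chord_span] by simp
qed

lemma trivalent_in_chord_span: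
  assumes diagram: "is_diagram K {#x, y, z#} (mset ls)" and len: "length ls = Suc n"
  shows "trivalent K x y z ls \<in> chord_span n"
proof (cases "x \<noteq> y \<and> x \<noteq> z \<and> y \<noteq> z")
  case False
  then have "trivalent K x y z ls = contract K (\<lambda>_. 0) ls"
    by (intro contract_cong levi_civita_eq_0) auto
  then show ?thesis
    using felem.subspace_0[OF subspace_chord_span] by (simp add: contract_def)
next
  case True
  then have "\<exists>j\<in>{1, 2}. (j, s) \<in> set ls" if "s \<in> {x, y, z}" for s
    using that by (intro diagram_leg_exists[OF diagram]) auto
  then obtain i j k where "i \<in> {1, 2}" "(i, x) \<in> set ls" "j \<in> {1, 2}" "(j, y) \<in> set ls"
    "k \<in> {1, 2}" "(k, z) \<in> set ls"
    by (metis insertCI)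
  moreover from this have "i = j \<or> j = k \<or> i = k" by auto
  ultimately obtain l p q r where same_strand: "(l, p) \<in> set ls" "(l, q) \<in> set ls"
    and "(p, q, r) \<in> {(x, y, z), (y, z, x), (z, x, y)}" by blast
  then have legs: "{#x, y, z#} = {#p, q, r#}" "p \<noteq> q" "p \<noteq> r" "q \<noteq> r"
    using True by (auto simp: add_mset_commute)
  have "(l, p) \<noteq> (l, q)" using legs(2) by simp
  with same_strand show ?thesis
  proof (rule split_list_pair)
    fix u v w assume "ls = u @ (l, p) # v @ (l, q) # w"
    with diagram len show ?thesis using legs by (rule trivalent_rearranged_in_chord_span)
  next
    fix u v w assume "ls = u @ (l, q) # v @ (l, p) # w"
    moreover have "{#x, y, z#} = {#q, p, r#}" using legs(1) by (simp add: add_mset_commute)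
    ultimately show ?thesis
      using diagram len legs(2-4)
      by (intro trivalent_rearranged_in_chord_span[of K x y z ls n u l q v p w r]) auto
  qed
qed

section \<open>Moving the feet of chords\<close>

lemma chord_diagram_swap:
  assumes "is_diagram K {#} (mset (u @ p # q # v))" "length (u @ v) = n"
  shows "chord_diagram K (u @ p # q # v) - chord_diagram K (u @ q # p # v) \<in> chord_span n"
proof -
  obtain j a k b where letters: "p = (j, a)" "q = (k, b)" by fastforce
  have "trivalent (insert c K) a b c (u @ (j, c) # v) \<in> chord_span n" if "c \<notin> K" for c
    using diagram_commutator[OF assms(1)[unfolded letters] that] assms(2)
    by (intro trivalent_in_chord_span) simp_all
  then show ?thesis
    using assms(1) unfolding letters by (intro contract_swap_in_chord_span) simp_all
qed

lemma chord_diagram_move: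
  assumes "is_diagram K {#} (mset (u @ v @ p # w))" "length (u @ v @ w) = Suc n"
  shows "chord_diagram K (u @ v @ p # w) - chord_diagram K (u @ p # v @ w) \<in> chord_span n"
proof -
  let ?f = "chord_diagram K" and ?M = "mset (u @ v @ p # w)"
  have "?f (u' @ p # q # w') - ?f (u' @ q # p # w') \<in> chord_span n"
    if "mset (u' @ p # q # w') = ?M" for u' q w'
    using that mset_eq_length[OF that] assms by (intro chord_diagram_swap) simp_all
  then have "?f (u @ p # v @ w) - ?f (u @ v @ p # w) \<in> chord_span n"
    by (intro subspace_move[where f = ?f and M = ?M] subspace_chord_span) simp_all
  then show ?thesis
    using felem.subspace_neg[OF subspace_chord_span] by fastforce
qed

section \<open>Chord diagrams as polynomials in the generators\<close>

definition uequiv_closure :: "felem set \<Rightarrow> felem set" where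
  "uequiv_closure A = {f. \<exists>g\<in>A. uequiv f g}"

lemma uequiv_closure_base: "A \<subseteq> uequiv_closure A"
  unfolding uequiv_closure_def using uequiv_refl by blast

lemma uequiv_closure_minimal: "A \<subseteq> uequiv_closure B \<Longrightarrow> uequiv_closure A \<subseteq> uequiv_closure B"
  unfolding uequiv_closure_def using uequiv_trans by blast

lemma subspace_uequiv_closure:
  assumes "felem.subspace A"
  shows "felem.subspace (uequiv_closure A)"
  unfolding uequiv_closure_def using assms
  by (intro felem.subspaceI)
    (blast intro: uequiv_refl uequiv_add uequiv_scale
      felem.subspace_0 felem.subspace_add felem.subspace_scale)+

lemma U_ideal_subset_uequiv_closure: "felem.subspace A \<Longrightarrow> U_ideal \<subseteq> uequiv_closure A"
  using felem.subspace_0 by (force simp: uequiv_closure_def uequiv_iff_diff)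

lemma uequiv_closure_mult_left:
  assumes "h \<in> letter_span" "\<And>g. g \<in> A \<Longrightarrow> fa_mult h g \<in> uequiv_closure A" "f \<in> uequiv_closure A"
  shows "fa_mult h f \<in> uequiv_closure A"
proof -
  obtain g where representative: "g \<in> A" "uequiv f g" using assms(3) by (auto simp: uequiv_closure_def)
  have "uequiv (fa_mult h f) (fa_mult h g)" using assms(1) representative(2) by (rule uequiv_mult_left)
  with assms(2)[OF representative(1)] show ?thesis
    unfolding uequiv_closure_def using uequiv_trans by blast
qed

definition chord_generator :: "nat \<Rightarrow> nat \<Rightarrow> felem" where
  "chord_generator j k = (\<Sum>i\<in>sl2_index. fa_word [(j, i), (k, i)])"

lemma generators_eq_chord_generator:
  "cas1 = chord_generator 1 1" "cas2 = chord_generator 2 2" "xel = chord_generator 1 2"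
  by (simp_all add: fun_eq_iff felem_apply cas1_def cas2_def xel_def chord_generator_def sl2_index_def)

lemma chord_generator_in_letter_span: "j \<in> {1, 2} \<Longrightarrow> k \<in> {1, 2} \<Longrightarrow> chord_generator j k \<in> letter_span"
  unfolding chord_generator_def by (intro letter_span_intros) (auto simp: mem_letters_iff)

lemma gen_alg_subset_letter_span: "gen_alg \<subseteq> letter_span"
proof
  fix f assume "f \<in> gen_alg"
  then show "f \<in> letter_span"
    by induction (simp_all add: generators_eq_chord_generator chord_generator_in_letter_span
        fa_add_eq_plus fa_mult_letter_span letter_span_intros)
qed

lemma subspace_gen_alg: "felem.subspace gen_alg"
proof (rule felem.subspaceI)
  show "0 \<in> gen_alg" using gen_alg.smult[OF gen_alg.one, of 0] by simp
qed (use gen_alg.add gen_alg.smult in \<open>simp_all add: fa_add_eq_plus\<close>)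

lemmas subspace_gen_alg_closure = subspace_uequiv_closure[OF subspace_gen_alg]

lemma chord_diagram_cons:
  assumes "a \<notin> K" "a \<notin> snd ` set ls"
  shows "chord_diagram (insert a K) ((j, a) # (k, a) # ls)
    = fa_mult (chord_generator j k) (chord_diagram K ls)"
proof -
  have "chord_diagram (insert a K) ((j, a) # (k, a) # ls)
      = (\<Sum>\<phi>\<in>K \<rightarrow>\<^sub>E sl2_index. \<Sum>i\<in>sl2_index. fa_word ((j, i) # (k, i) # map (apsnd \<phi>) ls))"
    using assms by (simp add: contract_insert map_apsnd_fun_upd_other)
  also have "\<dots> = fa_mult (chord_generator j k) (chord_diagram K ls)"
    by (simp add: chord_generator_def contract_def fa_mult_left.sum fa_mult_right.sum fa_mult_word_word
        sum.swap[of _ sl2_index])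
  finally show ?thesis .
qed

lemma diagram_remove_chord:
  assumes "is_diagram K {#} (mset ((j, a) # (k, a) # ls))"
  shows "a \<in> K" "a \<notin> snd ` set ls" "is_diagram (K - {a}) {#} (mset ls)"
proof -
  have "is_diagram K {#a, a#} (mset ls)" using assms by (simp add: is_diagram_def)
  from diagram_remove_label[OF this] show "a \<notin> snd ` set ls" "is_diagram (K - {a}) {#} (mset ls)"
    by simp_all
  show "a \<in> K" using assms by (simp add: is_diagram_def)
qed

lemma chord_diagram_cons_in_gen_alg_closure:
  assumes diagram: "is_diagram K {#} (mset ((j, a) # (k, a) # ls))"
    and smaller: "\<And>K. is_diagram K {#} (mset ls) \<Longrightarrow> chord_diagram K ls \<in> uequiv_closure gen_alg"
    and lower: "chord_span (length ls) \<subseteq> uequiv_closure gen_alg"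
  shows "chord_diagram K ((j, a) # (k, a) # ls) \<in> uequiv_closure gen_alg"
proof -
  have ordered: "chord_diagram K ((j, a) # (k, a) # ls) \<in> uequiv_closure gen_alg"
    if diagram: "is_diagram K {#} (mset ((j, a) # (k, a) # ls))" and "j \<le> k" for j k
  proof -
    note removed = diagram_remove_chord[OF diagram]
    have strands: "j \<in> {1, 2}" "k \<in> {1, 2}" using diagram by (auto simp: is_diagram_def)
    with \<open>j \<le> k\<close> have "chord_generator j k \<in> gen_alg"
      using gen_alg.c1 gen_alg.c2 gen_alg.x by (auto simp: generators_eq_chord_generator)
    then have "fa_mult (chord_generator j k) g \<in> uequiv_closure gen_alg" if "g \<in> gen_alg" for g
      using gen_alg.mult that uequiv_closure_base by blast
    from uequiv_closure_mult_left[OF chord_generator_in_letter_span[OF strands] this smaller[OF removed(3)]]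
    show ?thesis
      using chord_diagram_cons[of a "K - {a}" ls j k] removed by (simp add: insert_absorb)
  qed
  show ?thesis
  proof (cases "j \<le> k")
    case True
    with diagram show ?thesis by (rule ordered)
  next
    case False
    then have "chord_diagram K ((k, a) # (j, a) # ls) \<in> uequiv_closure gen_alg"
      using diagram by (intro ordered) (simp_all add: add_mset_commute)
    moreover have "chord_diagram K ((j, a) # (k, a) # ls) - chord_diagram K ((k, a) # (j, a) # ls)
        \<in> uequiv_closure gen_alg"
      using chord_diagram_swap[of K "[]"] diagram lower by auto
    ultimately show ?thesis
      using subspace_mem_of_diff[OF subspace_gen_alg_closure] by blast
  qed
qed

lemma chord_diagram_in_gen_alg_closure:
  "is_diagram K {#} (mset ls) \<Longrightarrow> chord_diagram K ls \<in> uequiv_closure gen_alg"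
proof (induction "length ls" arbitrary: K ls rule: less_induct)
  case less
  have lower: "chord_span n \<subseteq> uequiv_closure gen_alg" if "n < length ls" for n
    unfolding chord_span_def using that less.hyps U_ideal_subset_uequiv_closure[OF subspace_gen_alg]
    by (intro felem.span_minimal subspace_gen_alg_closure) auto
  show ?case
  proof (cases ls)
    case Nil
    have "fa_word [] \<in> uequiv_closure gen_alg" using gen_alg.one uequiv_closure_base by blast
    then show ?thesis
      by (auto simp: Nil contract_def simp del: sum_constant
          intro: felem.subspace_sum[OF subspace_gen_alg_closure])
  next
    case (Cons p ps)
    obtain j a where first: "p = (j, a)" by fastforce
    have "is_diagram K {#a#} (mset ps)"
      using less.prems by (simp add: is_diagram_def Cons first)
    from diagram_leg_exists[OF this, of a] obtain k where "(k, a) \<in> set ps" by auto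
    then obtain v w where "ps = v @ (k, a) # w" by (meson split_list)
    then have word: "ls = (j, a) # v @ (k, a) # w" using Cons first by simp
    have "chord_diagram K ls - chord_diagram K ((j, a) # (k, a) # v @ w) \<in> chord_span (length (v @ w))"
      using chord_diagram_move[of K "[(j, a)]" v "(k, a)" w] less.prems by (simp add: word)
    moreover have "chord_diagram K ((j, a) # (k, a) # v @ w) \<in> uequiv_closure gen_alg"
      using less.prems by (intro chord_diagram_cons_in_gen_alg_closure less.hyps lower)
        (simp_all add: word add_mset_commute)
    ultimately show ?thesis
      using subspace_mem_of_diff[OF subspace_gen_alg_closure] lower[of "length (v @ w)"]
      by (auto simp: word)
  qed
qed

section \<open>Chord diagrams as shares\<close>

lemma uequiv_word_sort_strands:
  assumes "set w \<subseteq> letters"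
  shows "uequiv (fa_word w) (fa_word (filter (\<lambda>p. fst p = 1) w @ filter (\<lambda>p. fst p = 2) w))"
  using assms
proof (induction w)
  case Nil
  show ?case by simp
next
  case (Cons p w)
  let ?u = "filter (\<lambda>p. fst p = 1) w" and ?v = "filter (\<lambda>p. fst p = 2) w"
  have cons: "uequiv (fa_word (p # w)) (fa_word (p # ?u @ ?v))"
    using uequiv_mult_left[OF fa_word_in_letter_span Cons.IH, of "[p]"] Cons.prems
    by (simp add: fa_mult_word_word)
  consider (strand1) "fst p = 1" | (strand2) "fst p = 2" using Cons.prems by (auto simp: letters_def)
  then show ?case
  proof cases
    case strand1
    with cons show ?thesis by simp
  next
    case strand2
    have "fa_word ([] @ p # ?u @ ?v) - fa_word ([] @ ?u @ p # ?v) \<in> U_ideal"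
    proof (rule subspace_move[OF subspace_U_ideal _ refl])
      fix u' q w'
      assume first_strand: "q \<in> set ?u" and perm: "mset (u' @ p # q # w') = mset ([] @ p # ?u @ ?v)"
      have "set (u' @ p # q # w') \<subseteq> letters"
        unfolding mset_eq_setD[OF perm] using Cons.prems by auto
      then show "fa_word (u' @ p # q # w') - fa_word (u' @ q # p # w') \<in> U_ideal"
        using uequiv_word_swap[of p q u' w'] strand2 first_strand by (simp add: uequiv_iff_diff)
    qed
    then have "uequiv (fa_word (p # ?u @ ?v)) (fa_word (?u @ p # ?v))"
      by (simp add: uequiv_iff_diff)
    from uequiv_trans[OF cons this] show ?thesis using strand2 by simp
  qed
qed

definition strand_word :: "nat list \<times> nat list \<Rightarrow> letter list" where
  "strand_word S = map (Pair 1) (fst S) @ map (Pair 2) (snd S)"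

lemma snd_set_strand_word: "snd ` set (strand_word S) = set (fst S @ snd S)"
  by (simp add: strand_word_def image_Un image_image)

lemma w_sl2_eq_chord_diagram: "w_sl2 S = chord_diagram (set (fst S @ snd S)) (strand_word S)"
  by (simp add: fun_eq_iff felem_apply w_sl2_def contract_def strand_word_def sl2_index_def comp_def)

lemma diagram_strand_word:
  "is_diagram (set (fst S @ snd S)) {#} (mset (strand_word S)) \<longleftrightarrow> is_share S"
  by (auto simp: is_diagram_def strand_word_def paired_def is_share_def image_image multiset.map_comp comp_def
      count_list_append simp flip: count_mset)

definition share_span :: "felem set" where
  "share_span = felem.span (w_sl2 ` Collect is_share)"

lemma subspace_share_span: "felem.subspace share_span"
  by (simp add: share_span_def)

lemmas subspace_share_closure = subspace_uequiv_closure[OF subspace_share_span]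

lemma w_sl2_in_share_span: "is_share S \<Longrightarrow> w_sl2 S \<in> share_span"
  unfolding share_span_def by (rule felem.span_base) simp

lemma share_span_minimal: "w_sl2 ` Collect is_share \<subseteq> V \<Longrightarrow> felem.subspace V \<Longrightarrow> share_span \<subseteq> V"
  unfolding share_span_def by (rule felem.span_minimal)

lemma share_span_eq_list_sums:
  "share_span = {f. \<exists>L. (\<forall>(c, S)\<in>set L. is_share S) \<and> f = (\<lambda>w. \<Sum>(c, S)\<leftarrow>L. c * w_sl2 S w)}"
  (is "_ = ?R")
proof
  show "share_span \<subseteq> ?R"
  proof
    fix f assume "f \<in> share_span"
    then show "f \<in> ?R"
      unfolding share_span_def
    proof (induction rule: felem.span_induct_alt)
      case base
      show ?case by (auto intro!: exI[of _ "[]"] simp: zero_fun_def)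
    next
      case (step c f g)
      then obtain S L where "is_share S" "f = w_sl2 S" "\<forall>(c, S)\<in>set L. is_share S"
        "g = (\<lambda>w. \<Sum>(c, S)\<leftarrow>L. c * w_sl2 S w)" by auto
      then show ?case by (auto intro!: exI[of _ "(c, S) # L"] simp: fun_eq_iff felem_apply)
    qed
  qed
  have "(\<lambda>w. \<Sum>(c, S)\<leftarrow>L. c * w_sl2 S w) \<in> share_span" if "\<forall>(c, S)\<in>set L. is_share S"
    for L :: "(complex \<times> (nat list \<times> nat list)) list"
    using that
  proof (induction L)
    case Nil
    show ?case using felem.span_zero by (simp add: share_span_def zero_fun_def)
  next
    case (Cons x L)
    obtain c S where pair: "x = (c, S)" by (cases x)
    have "(\<lambda>w. \<Sum>(c, S)\<leftarrow>x # L. c * w_sl2 S w) = c *\<^sub>a w_sl2 S + (\<lambda>w. \<Sum>(c, S)\<leftarrow>L. c * w_sl2 S w)"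
      by (simp add: fun_eq_iff felem_apply pair)
    also have "\<dots> \<in> share_span"
      using Cons pair
      by (intro felem.subspace_add felem.subspace_scale subspace_share_span w_sl2_in_share_span) auto
    finally show ?case .
  qed
  then show "?R \<subseteq> share_span" by blast
qed

lemma in_w_image_iff_closure: "in_w_image f \<longleftrightarrow> f \<in> uequiv_closure share_span"
  unfolding in_w_image_def uequiv_closure_def share_span_eq_list_sums by blast

lemma chord_diagram_in_share_closure:
  assumes "is_diagram (snd ` set ls) {#} (mset ls)"
  shows "chord_diagram (snd ` set ls) ls \<in> uequiv_closure share_span"
proof -
  let ?u = "filter (\<lambda>p. fst p = 1) ls" and ?v = "filter (\<lambda>p. fst p = 2) ls"
  define S where "S = (map snd ?u, map snd ?v)"
  have "map (\<lambda>p. (j, snd p)) (filter (\<lambda>p. fst p = j) ls) = filter (\<lambda>p. fst p = j) ls" for j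
    by (auto intro!: map_idI)
  then have word: "strand_word S = ?u @ ?v"
    by (simp add: strand_word_def S_def comp_def)
  have "?v = filter (\<lambda>p. fst p \<noteq> 1) ls"
    using assms by (intro filter_cong) (auto simp: is_diagram_def)
  then have sorted: "mset (strand_word S) = mset ls"
    by (simp add: word flip: multiset_partition)
  then have labels: "set (fst S @ snd S) = snd ` set ls"
    using snd_set_strand_word[of S] mset_eq_setD by metis
  have "is_share S"
    using assms diagram_strand_word[of S] unfolding labels sorted by simp
  moreover have "uequiv (chord_diagram (snd ` set ls) ls) (w_sl2 S)"
    unfolding w_sl2_eq_chord_diagram labels word contract_def
  proof (intro uequiv_sum uequiv_scale)
    fix \<phi> assume "\<phi> \<in> snd ` set ls \<rightarrow>\<^sub>E sl2_index"
    with assms have "set (map (apsnd \<phi>) ls) \<subseteq> letters"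
      by (intro set_map_apsnd_subset_letters[where K = "snd ` set ls"]) (simp_all add: is_diagram_def)
    from uequiv_word_sort_strands[OF this]
    show "uequiv (fa_word (map (apsnd \<phi>) ls)) (fa_word (map (apsnd \<phi>) (?u @ ?v)))"
      by (simp add: filter_map comp_def)
  qed
  ultimately show ?thesis
    unfolding uequiv_closure_def using w_sl2_in_share_span by blast
qed

lemma chord_generator_mult_share:
  assumes "is_share S" "j \<in> {1, 2}" "k \<in> {1, 2}"
  shows "fa_mult (chord_generator j k) (w_sl2 S) \<in> uequiv_closure share_span"
proof -
  let ?K = "set (fst S @ snd S)"
  obtain a where fresh: "a \<notin> ?K" using ex_new_if_finite[OF infinite_UNIV_nat] by blast
  let ?ls = "(j, a) # (k, a) # strand_word S"
  note labels = snd_set_strand_word[of S]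
  have "is_diagram (insert a ?K) {#} (mset ?ls)"
    using assms fresh labels unfolding diagram_strand_word[symmetric]
    by (auto simp: is_diagram_def paired_add_pair)
  moreover have "snd ` set ?ls = insert a ?K" using labels by simp
  moreover have "fa_mult (chord_generator j k) (w_sl2 S) = chord_diagram (insert a ?K) ?ls"
    unfolding w_sl2_eq_chord_diagram using fresh labels by (subst chord_diagram_cons) simp_all
  ultimately show ?thesis using chord_diagram_in_share_closure[of ?ls] by simp
qed

lemma share_closure_mult_generator:
  assumes "f \<in> uequiv_closure share_span" "h \<in> {cas1, cas2, xel}"
  shows "fa_mult h f \<in> uequiv_closure share_span"
proof -
  obtain j k where strands: "j \<in> {1, 2}" "k \<in> {1, 2}" and generator: "h = chord_generator j k"
    using assms(2) generators_eq_chord_generator by auto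
  have "w_sl2 ` Collect is_share \<subseteq> {g. fa_mult h g \<in> uequiv_closure share_span}"
    using chord_generator_mult_share strands generator by auto
  then have "share_span \<subseteq> {g. fa_mult h g \<in> uequiv_closure share_span}"
    by (intro share_span_minimal fa_mult_right.subspace_linear_preimage subspace_share_closure)
  then have "fa_mult h g \<in> uequiv_closure share_span" if "g \<in> share_span" for g
    using that by blast
  from uequiv_closure_mult_left[OF _ this assms(1)] show ?thesis
    using chord_generator_in_letter_span[OF strands] generator by blast
qed

lemma share_closure_mult_gen_alg:
  "g \<in> gen_alg \<Longrightarrow> f \<in> uequiv_closure share_span \<Longrightarrow> fa_mult g f \<in> uequiv_closure share_span"
proof (induction arbitrary: f rule: gen_alg.induct)
  case (add g g')
  then show ?case
    by (simp add: fa_add_eq_plus fa_mult_left.add felem.subspace_add[OF subspace_share_closure])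
next
  case (smult g c)
  then show ?case
    by (simp add: fa_mult_left.scale felem.subspace_scale[OF subspace_share_closure])
qed (simp_all add: fa_mult_one_left share_closure_mult_generator fa_mult_assoc)

lemma share_closure_eq_gen_alg_closure: "uequiv_closure share_span = uequiv_closure gen_alg"
proof (intro equalityI uequiv_closure_minimal)
  have "w_sl2 S \<in> uequiv_closure gen_alg" if "is_share S" for S
    unfolding w_sl2_eq_chord_diagram using that
    by (intro chord_diagram_in_gen_alg_closure) (simp only: diagram_strand_word)
  then show "share_span \<subseteq> uequiv_closure gen_alg"
    by (intro share_span_minimal subspace_uequiv_closure subspace_gen_alg) auto
next
  have "w_sl2 ([], []) = fa_word []" by (simp add: w_sl2_def)
  moreover have "w_sl2 ([], []) \<in> share_span" by (rule w_sl2_in_share_span) (simp add: is_share_def)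
  ultimately have "fa_word [] \<in> uequiv_closure share_span"
    using uequiv_closure_base by auto
  then show "gen_alg \<subseteq> uequiv_closure share_span"
    using share_closure_mult_gen_alg[of _ "fa_word []"] by (auto simp: fa_mult_one_right)
qed

section \<open>Pairs of dual Verma modules\<close>

text \<open>The dual Verma module of highest weight \<open>l\<close>: \<open>e\<close> acts as the derivative on polynomials, written in
  divided powers, and \<open>x\<^sub>1 = (e + f)/2\<close>, \<open>x\<^sub>2 = -\<i>(e - f)/2\<close>, \<open>x\<^sub>3 = h/2\<close>. The truncated subtraction at
  \<open>m = 0\<close> is harmless because of the factor \<open>m\<close>.\<close>

definition verma :: "complex \<Rightarrow> nat \<Rightarrow> (nat \<Rightarrow> complex) \<Rightarrow> nat \<Rightarrow> complex" where
  "verma l a g m =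
    (if a = 1 then (g (Suc m) + of_nat m * (l - of_nat m + 1) * g (m - 1)) / 2
     else if a = 2 then - \<i> * (g (Suc m) - of_nat m * (l - of_nat m + 1) * g (m - 1)) / 2
     else if a = 3 then (l - 2 * of_nat m) * g m / 2 else 0)"

lemma verma_commutator:
  assumes "a \<in> sl2_index" "b \<in> sl2_index"
  shows "verma l a (verma l b g) m
    = verma l b (verma l a g) m + (\<Sum>c\<in>sl2_index. \<i> * levi_civita a b c * verma l c g m)"
  using assms
  by (cases m) (auto simp: sl2_index_def verma_def levi_civita_def field_simps)

lemma verma_casimir: "(\<Sum>a\<in>sl2_index. verma l a (verma l a g) m) = l * (l + 2) / 4 * g m"
  by (cases m) (auto simp: sl2_index_def verma_def field_simps)

type_synonym vec = "nat \<Rightarrow> nat \<Rightarrow> complex"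

definition vec_smult :: "complex \<Rightarrow> vec \<Rightarrow> vec" (infixr "*\<^sub>v" 75) where
  "c *\<^sub>v F = (\<lambda>m n. c * F m n)"

lemma vec_smult_apply: "(c *\<^sub>v F) m n = c * F m n"
  by (simp add: vec_smult_def)

interpretation vec: vector_space vec_smult
  by unfold_locales (simp_all add: fun_eq_iff vec_smult_apply plus_fun_apply algebra_simps)

definition endo_smult :: "complex \<Rightarrow> (vec \<Rightarrow> vec) \<Rightarrow> vec \<Rightarrow> vec" where
  "endo_smult c A = (\<lambda>F. c *\<^sub>v A F)"

interpretation endo: vector_space endo_smult
  by unfold_locales (simp_all add: fun_eq_iff endo_smult_def vec_smult_apply plus_fun_apply algebra_simps)

interpretation felem_endo: vector_space_pair fa_smult endo_smult ..

lemma endo_apply: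
  fixes A B :: "vec \<Rightarrow> vec"
  shows "(0 :: vec \<Rightarrow> vec) F = 0" "(A + B) F = A F + B F" "(A - B) F = A F - B F"
    "(\<Sum>i\<in>I. C i) F = (\<Sum>i\<in>I. (C i :: vec \<Rightarrow> vec) F)" "endo_smult c A F = c *\<^sub>v A F"
  by (simp_all add: plus_fun_apply zero_fun_apply minus_apply sum_fun_apply endo_smult_def)

lemmas vec_apply = plus_fun_apply zero_fun_apply sum_fun_apply vec_smult_apply

definition letter_act :: "complex \<Rightarrow> complex \<Rightarrow> letter \<Rightarrow> vec \<Rightarrow> vec" where
  "letter_act l1 l2 p F = (\<lambda>m n.
    if fst p = 1 then verma l1 (snd p) (\<lambda>m'. F m' n) m else verma l2 (snd p) (F m) n)"

interpretation letter_act: Vector_Spaces.linear vec_smult vec_smult "letter_act l1 l2 p" for l1 l2 p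
  by unfold_locales (simp_all add: fun_eq_iff vec_apply letter_act_def verma_def field_simps)

lemma letter_act_swap:
  assumes "p \<in> letters" "q \<in> letters"
  shows "letter_act l1 l2 p (letter_act l1 l2 q F) = letter_act l1 l2 q (letter_act l1 l2 p F)
    + (if fst p = fst q
       then \<Sum>c\<in>sl2_index. (\<i> * levi_civita (snd p) (snd q) c) *\<^sub>v letter_act l1 l2 (fst p, c) F else 0)"
proof -
  obtain j a k b where letters: "p = (j, a)" "q = (k, b)" "j \<in> {1, 2}" "k \<in> {1, 2}"
    "a \<in> sl2_index" "b \<in> sl2_index"
    using assms by (cases p; cases q) (auto simp: mem_letters_iff)
  show ?thesis
  proof (cases "j = k")
    case True
    then show ?thesis
      using letters verma_commutator[OF letters(5,6)] by (auto simp: fun_eq_iff vec_apply letter_act_def)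
  next
    case False
    then show ?thesis
      using letters by (auto simp: fun_eq_iff vec_apply letter_act_def verma_def sl2_index_def field_simps)
  qed
qed

definition word_act :: "complex \<Rightarrow> complex \<Rightarrow> letter list \<Rightarrow> vec \<Rightarrow> vec" where
  "word_act l1 l2 w = foldr (letter_act l1 l2) w"

lemma word_act_simps [simp]:
  "word_act l1 l2 [] F = F"
  "word_act l1 l2 (p # w) F = letter_act l1 l2 p (word_act l1 l2 w F)"
  "word_act l1 l2 (u @ w) F = word_act l1 l2 u (word_act l1 l2 w F)"
  by (simp_all add: word_act_def)

interpretation word_act: Vector_Spaces.linear vec_smult vec_smult "word_act l1 l2 w" for l1 l2 w
proof unfold_locales
  show "word_act l1 l2 w (F + G) = word_act l1 l2 w F + word_act l1 l2 w G" for F G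
    by (induction w) (simp_all add: letter_act.add)
  show "word_act l1 l2 w (c *\<^sub>v F) = c *\<^sub>v word_act l1 l2 w F" for c F
    by (induction w) (simp_all add: letter_act.scale)
qed

text \<open>Extending linearly avoids finite-support conditions; off the span of the words the values are junk.\<close>

definition alg_act :: "complex \<Rightarrow> complex \<Rightarrow> felem \<Rightarrow> vec \<Rightarrow> vec" where
  "alg_act l1 l2 = felem_endo.construct (range fa_word) (\<lambda>f. word_act l1 l2 (inv fa_word f))"

interpretation alg_act: Vector_Spaces.linear fa_smult endo_smult "alg_act l1 l2" for l1 l2
  unfolding alg_act_def by (rule felem_endo.linear_construct[OF independent_fa_words])

lemma alg_act_word [simp]: "alg_act l1 l2 (fa_word w) = word_act l1 l2 w"
  by (simp add: alg_act_def felem_endo.construct_basis[OF independent_fa_words] inv_f_f[OF inj_fa_word])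

lemma alg_act_linear_combination:
  "alg_act l1 l2 (c *\<^sub>a fa_word u + f) F = c *\<^sub>v word_act l1 l2 u F + alg_act l1 l2 f F"
  by (simp add: alg_act.add alg_act.scale endo_apply)

lemma alg_act_scale_vec:
  "f \<in> letter_span \<Longrightarrow> alg_act l1 l2 f (z *\<^sub>v F) = z *\<^sub>v alg_act l1 l2 f F"
  by (induction rule: letter_span_induct)
    (simp_all add: alg_act_linear_combination word_act.scale vec.scale_right_distrib mult.commute endo_apply)

lemma alg_act_mult:
  assumes "f \<in> letter_span" "g \<in> letter_span"
  shows "alg_act l1 l2 (fa_mult f g) F = alg_act l1 l2 f (alg_act l1 l2 g F)"
proof -
  have word: "alg_act l1 l2 (fa_mult (fa_word u) g) F = word_act l1 l2 u (alg_act l1 l2 g F)" for u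
    using assms(2)
    by (induction)
      (simp_all add: fa_mult_right.add fa_mult_right.scale fa_mult_word_word alg_act_linear_combination
        word_act.add word_act.scale endo_apply)
  show ?thesis
    using assms(1)
  proof induction
    case (step c u f)
    then show ?case
      by (simp add: fa_mult_left.add fa_mult_left.scale alg_act_linear_combination alg_act.add alg_act.scale
          endo_apply word)
  qed (simp add: endo_apply)
qed

lemma alg_act_U_ideal: "f \<in> U_ideal \<Longrightarrow> alg_act l1 l2 f = 0"
proof (induction rule: U_ideal.induct)
  case zero
  show ?case by (simp add: fa_zero_eq_0)
next
  case (gen p q u v)
  have "alg_act l1 l2 (fa_mult (fa_mult (fa_word u) (U_rel p q)) (fa_word v)) F = 0" for F
    unfolding fa_mult_U_rel[OF gen(1,2)]
    by (simp add: alg_act.diff alg_act.sum alg_act.scale endo_apply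
        letter_act_swap[OF gen(1,2)] word_act.add word_act.sum word_act.scale)
  then show ?case by (simp add: fun_eq_iff endo_apply)
next
  case (add f g)
  then show ?case by (simp add: fa_add_eq_plus alg_act.add)
next
  case (smult f c)
  then show ?case by (simp add: alg_act.scale)
qed

section \<open>Simultaneous eigenvectors\<close>

lemma eigenvector_mult:
  assumes "f \<in> letter_span" "g \<in> letter_span"
    and "alg_act l1 l2 f F = y *\<^sub>v F" "alg_act l1 l2 g F = z *\<^sub>v F"
  shows "alg_act l1 l2 (fa_mult f g) F = (y * z) *\<^sub>v F"
  using assms by (simp add: alg_act_mult alg_act_scale_vec mult.commute)

lemma fa_pow_in_letter_span: "f \<in> letter_span \<Longrightarrow> fa_pow f n \<in> letter_span"
  by (induction n) (simp_all add: fa_word_in_letter_span fa_mult_letter_span)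

lemma eigenvector_pow:
  "f \<in> letter_span \<Longrightarrow> alg_act l1 l2 f F = z *\<^sub>v F \<Longrightarrow> alg_act l1 l2 (fa_pow f n) F = z ^ n *\<^sub>v F"
  by (induction n) (simp_all add: eigenvector_mult fa_pow_in_letter_span)

text \<open>Up to scaling, the polynomial \<open>(z\<^sub>1 - z\<^sub>2)\<^sup>k\<close> in divided powers: it is killed by \<open>e\<close> acting
  diagonally, so the Casimir element of the diagonal subalgebra acts on it by a scalar.\<close>

definition singular_vec :: "nat \<Rightarrow> vec" where
  "singular_vec k m n = (if m + n = k then (-1) ^ n else 0)"

definition casimir_eigenvalue :: "complex \<Rightarrow> complex" where
  "casimir_eigenvalue l = l * (l + 2) / 4"

definition xel_eigenvalue :: "complex \<Rightarrow> complex \<Rightarrow> nat \<Rightarrow> complex" where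
  "xel_eigenvalue l1 l2 k = l1 * l2 / 4 - of_nat k * (l1 + l2) / 2 + of_nat k * (of_nat k - 1) / 2"

lemma alg_act_chord_generator:
  "alg_act l1 l2 (chord_generator j k) F m n
    = (\<Sum>i\<in>sl2_index. letter_act l1 l2 (j, i) (letter_act l1 l2 (k, i) F) m n)"
  by (simp add: chord_generator_def alg_act.sum sum_fun_apply)

lemma alg_act_cas1: "alg_act l1 l2 cas1 F = casimir_eigenvalue l1 *\<^sub>v F"
  by (simp add: fun_eq_iff generators_eq_chord_generator alg_act_chord_generator vec_smult_apply
      letter_act_def verma_casimir casimir_eigenvalue_def)

lemma alg_act_cas2: "alg_act l1 l2 cas2 F = casimir_eigenvalue l2 *\<^sub>v F"
  by (simp add: fun_eq_iff generators_eq_chord_generator alg_act_chord_generator vec_smult_apply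
      letter_act_def verma_casimir casimir_eigenvalue_def)

lemma alg_act_xel: "alg_act l1 l2 xel (singular_vec k) = xel_eigenvalue l1 l2 k *\<^sub>v singular_vec k"
proof (intro ext)
  fix m n
  let ?c1 = "of_nat m * (l1 - of_nat m + 1)" and ?c2 = "of_nat n * (l2 - of_nat n + 1)"
  let ?v = "singular_vec k m n"
  have "?c2 * singular_vec k (Suc m) (n - 1) = - ?c2 * ?v"
    by (cases n) (auto simp: singular_vec_def algebra_simps)
  moreover have "?c1 * singular_vec k (m - 1) (Suc n) = - ?c1 * ?v"
    by (cases m) (auto simp: singular_vec_def algebra_simps)
  moreover have "alg_act l1 l2 xel (singular_vec k) m n
      = (?c2 * singular_vec k (Suc m) (n - 1) + ?c1 * singular_vec k (m - 1) (Suc n)) / 2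
        + (l1 - 2 * of_nat m) * (l2 - 2 * of_nat n) * ?v / 4"
    by (simp add: generators_eq_chord_generator alg_act_chord_generator letter_act_def verma_def
        sl2_index_def field_simps)
  ultimately have "alg_act l1 l2 xel (singular_vec k) m n
      = (- ?c2 * ?v + - ?c1 * ?v) / 2 + (l1 - 2 * of_nat m) * (l2 - 2 * of_nat n) * ?v / 4"
    by simp
  also have "\<dots> = xel_eigenvalue l1 l2 k * ?v"
    by (auto simp: singular_vec_def xel_eigenvalue_def field_simps)
  finally show "alg_act l1 l2 xel (singular_vec k) m n = (xel_eigenvalue l1 l2 k *\<^sub>v singular_vec k) m n"
    by (simp add: vec_smult_apply)
qed

lemma alg_act_monom3:
  "alg_act l1 l2 (monom3 (a, b, c)) (singular_vec k)
    = (casimir_eigenvalue l1 ^ a * casimir_eigenvalue l2 ^ b * xel_eigenvalue l1 l2 k ^ c) *\<^sub>v singular_vec k"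
proof -
  have "cas1 \<in> letter_span" "cas2 \<in> letter_span" "xel \<in> letter_span"
    using gen_alg_subset_letter_span gen_alg.intros by blast+
  then show ?thesis
    by (simp add: monom3_def eigenvector_mult eigenvector_pow fa_mult_letter_span fa_pow_in_letter_span
        alg_act_cas1 alg_act_cas2 alg_act_xel mult.assoc)
qed

lemma casimir_eigenvalue_surj: "surj casimir_eigenvalue"
proof (rule surjI)
  show "casimir_eigenvalue (csqrt (1 + 4 * x) - 1) = x" for x
    using power2_csqrt[of "1 + 4 * x"]
    by (simp add: casimir_eigenvalue_def power2_eq_square field_simps)
qed

lemma infinite_range_xel_eigenvalue: "infinite (range (xel_eigenvalue l1 l2))"
proof
  assume "finite (range (xel_eigenvalue l1 l2))"
  then obtain k0 where fiber: "infinite {k. xel_eigenvalue l1 l2 k = xel_eigenvalue l1 l2 k0}"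
    using pigeonhole_infinite[of UNIV "xel_eigenvalue l1 l2"] by auto
  let ?c = "l1 + l2 + 1 - of_nat k0"
  have "k = k0 \<or> of_nat k = ?c" if "xel_eigenvalue l1 l2 k = xel_eigenvalue l1 l2 k0" for k
  proof -
    have "(of_nat k - of_nat k0) * (of_nat k - ?c) = 2 * (xel_eigenvalue l1 l2 k - xel_eigenvalue l1 l2 k0)"
      by (simp add: xel_eigenvalue_def field_simps)
    with that show ?thesis by simp
  qed
  then have "{k. xel_eigenvalue l1 l2 k = xel_eigenvalue l1 l2 k0} \<subseteq> {k0} \<union> of_nat -` {?c}"
    by auto
  moreover have "finite (of_nat -` {?c} :: nat set)"
    by (rule finite_vimageI) (simp_all add: inj_of_nat)
  ultimately show False using fiber finite_subset by blast
qed

section \<open>Algebraic independence\<close>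

lemma sum_monomials_eq_0_imp_coeff_eq_0:
  fixes r :: "'i \<Rightarrow> 'a :: idom" and e :: "'i \<Rightarrow> nat"
  assumes "finite M" "infinite {z. (\<Sum>m\<in>M. r m * z ^ e m) = 0}"
  shows "(\<Sum>m | m \<in> M \<and> e m = n. r m) = 0"
proof -
  define P where "P = (\<Sum>m\<in>M. monom (r m) (e m))"
  have "infinite {z. poly P z = 0}"
    using assms(2) by (simp add: P_def poly_sum poly_monom)
  then have "P = 0" using poly_roots_finite by blast
  then have "(\<Sum>m\<in>M. if e m = n then r m else 0) = 0"
    by (simp add: P_def coeff_sum poly_eq_iff)
  then show ?thesis using assms(1) by (simp add: sum.inter_filter)
qed

lemma polynomial3_eq_0:
  fixes p :: "nat \<times> nat \<times> nat \<Rightarrow> 'a :: {idom, ring_char_0}"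
  defines "M \<equiv> {m. p m \<noteq> 0}"
  assumes fin: "finite M"
    and roots: "\<And>x y. infinite {z. (\<Sum>(a, b, c)\<in>M. p (a, b, c) * x ^ a * y ^ b * z ^ c) = 0}"
  shows "p = (\<lambda>_. 0)"
proof
  fix m :: "nat \<times> nat \<times> nat"
  obtain a b c where components: "m = (a, b, c)" by (cases m)
  let ?M\<^sub>c = "{m \<in> M. snd (snd m) = c}" and ?M\<^sub>b\<^sub>c = "{m \<in> M. snd (snd m) = c \<and> fst (snd m) = b}"
  have "(\<Sum>m\<in>?M\<^sub>c. p m * x ^ fst m * y ^ fst (snd m)) = 0" for x y
    using roots[of x y] by (intro sum_monomials_eq_0_imp_coeff_eq_0 fin) (simp add: case_prod_unfold)
  then have "(\<Sum>m | m \<in> ?M\<^sub>c \<and> fst (snd m) = b. p m * x ^ fst m) = 0" for x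
    using fin by (intro sum_monomials_eq_0_imp_coeff_eq_0) (simp_all add: infinite_UNIV_char_0)
  then have "(\<Sum>m | m \<in> ?M\<^sub>b\<^sub>c \<and> fst m = a. p m) = 0"
    using fin by (intro sum_monomials_eq_0_imp_coeff_eq_0) (simp_all add: infinite_UNIV_char_0 conj_assoc)
  moreover have "{m. m \<in> ?M\<^sub>b\<^sub>c \<and> fst m = a} = {m} \<inter> M"
    by (auto simp: components)
  ultimately show "p m = 0" by (cases "p m = 0") (simp_all add: M_def)
qed

lemma algebraically_independent:
  fixes p :: "nat \<times> nat \<times> nat \<Rightarrow> complex"
  assumes fin: "finite {m. p m \<noteq> 0}" and zero: "uequiv (eval3 p) fa_zero"
  shows "p = (\<lambda>_. 0)"
proof (rule polynomial3_eq_0[OF fin])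
  fix x y :: complex
  obtain l1 l2 where weights: "casimir_eigenvalue l1 = x" "casimir_eigenvalue l2 = y"
    using casimir_eigenvalue_surj by (metis surj_def)
  have "(\<Sum>(a, b, c) \<in>{m. p m \<noteq> 0}. p (a, b, c) * x ^ a * y ^ b * xel_eigenvalue l1 l2 k ^ c) = 0" for k
  proof -
    have "eval3 p = (\<Sum>m | p m \<noteq> 0. p m *\<^sub>a monom3 m)"
      by (simp add: fun_eq_iff felem_apply eval3_def)
    then have "alg_act l1 l2 (eval3 p) (singular_vec k) k 0
        = (\<Sum>m | p m \<noteq> 0. p m * alg_act l1 l2 (monom3 m) (singular_vec k) k 0)"
      by (simp add: alg_act.sum alg_act.scale endo_apply vec_apply)
    moreover have "alg_act l1 l2 (eval3 p) = 0"
      using zero by (intro alg_act_U_ideal) (simp add: uequiv_iff_diff fa_zero_eq_0)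
    moreover have "alg_act l1 l2 (monom3 m) (singular_vec k) k 0
        = (case m of (a, b, c) \<Rightarrow> x ^ a * y ^ b * xel_eigenvalue l1 l2 k ^ c)" for m
      by (cases m) (simp add: weights alg_act_monom3 vec_smult_apply singular_vec_def)
    ultimately show ?thesis
      by (simp add: endo_apply zero_fun_apply case_prod_unfold mult.assoc)
  qed
  then have "range (xel_eigenvalue l1 l2)
      \<subseteq> {z. (\<Sum>(a, b, c) \<in>{m. p m \<noteq> 0}. p (a, b, c) * x ^ a * y ^ b * z ^ c) = 0}"
    by auto
  from infinite_super[OF this infinite_range_xel_eigenvalue]
  show "infinite {z. (\<Sum>(a, b, c)\<in>{m. p m \<noteq> 0}. p (a, b, c) * x ^ a * y ^ b * z ^ c) = 0}" .
qed

theorem theorem2: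
  shows "(\<forall>f. in_w_image f \<longleftrightarrow> (\<exists>g \<in> gen_alg. uequiv f g))
       \<and> (\<forall>p :: nat \<times> nat \<times> nat \<Rightarrow> complex.
            finite {m. p m \<noteq> 0} \<longrightarrow> uequiv (eval3 p) fa_zero \<longrightarrow> p = (\<lambda>_. 0))"
proof (intro conjI allI impI)
  show "in_w_image f \<longleftrightarrow> (\<exists>g \<in> gen_alg. uequiv f g)" for f
    by (simp add: in_w_image_iff_closure share_closure_eq_gen_alg_closure) (simp add: uequiv_closure_def)
  show "p = (\<lambda>_. 0)" if "finite {m. p m \<noteq> 0}" "uequiv (eval3 p) fa_zero" for p
    using that by (rule algebraically_independent)
qed

end
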